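(* Let $d \geq 1$ and let $\mathcal{P} \subset \mathbb{R}^d$ be a lattice polytope of dimension $d$. Let $b(\mathcal{P})$ denote the number of lattice points (points of $\mathbb{Z}^d$) belonging to the boundary $\partial \mathcal{P}$ of $\mathcal{P}$, and $c(\mathcal{P})$ the number of lattice points belonging to the interior of $\mathcal{P}$. Suppose that $c(\mathcal{P}) > 0$. Then \[ \mathrm{vol}(\mathcal{P}) \geq \frac{d \cdot c(\mathcal{P}) + (d-1)\cdot b(\mathcal{P}) - d^2 + 2}{d!}, \] where $\mathrm{vol}(\mathcal{P})$ is the Lebesgue volume of $\mathcal{P}$.
   Context: A lattice polytope of dimension $d$ in $\mathbb{R}^d$ is a convex polytope of dimension $d$ each of whose vertices belongs to $\mathbb{Z}^d$. *)

theory Defs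
  imports "HOL-Analysis.Analysis"
begin

definition lattice_points :: "(real ^ 'n) set" where
  "lattice_points = {x. \<forall>i. x $ i \<in> \<int>}"

definition lattice_polytope :: "(real ^ 'n) set \<Rightarrow> bool" where
  "lattice_polytope P \<longleftrightarrow>
     polytope P \<and> (\<forall>v. v extreme_point_of P \<longrightarrow> v \<in> lattice_points)"

text \<open>For a polytope both sets below are finite, so \<open>card\<close> is the honest number of points.\<close>

definition boundary_count :: "(real ^ 'n) set \<Rightarrow> nat" where
  "boundary_count P = card (frontier P \<inter> lattice_points)"

definition interior_count :: "(real ^ 'n) set \<Rightarrow> nat" where
  "interior_count P = card (interior P \<inter> lattice_points)"

end

theory Submission
  imports Defs
begin

text \<open>
  Place an interior lattice point at the origin. Costs on a finite set of vectors define a regular fan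
  whose maximal cones are spanned by the optimal bases of a linear program. In dimension \<open>n\<close>, inserting
  a new generator in the relative interior of a \<open>k\<close>-dimensional face (\<open>k \<ge> 2\<close>) is a stellar subdivision;
  at least \<open>n - k + 1\<close> maximal cones contain that face, so the number of cones grows by at least
  \<open>(n - k + 1) (k - 1) \<ge> n - 1\<close>.

  First, some \<open>m\<close> boundary lattice points span a complete fan in dimension \<open>d\<close> with at least
  \<open>2 + (d - 1) (m - d)\<close> cones; inserting the remaining boundary points gains at least \<open>d - 1\<close> cones each. Then the
  cones are lifted to \<open>\<real>\<^sup>d \<times> \<real>\<close> and, by linear programming with perturbed costs, extended
  to a regular triangulation of the cone over the whole polytope. Inserting the other interior lattice
  points there gains at least \<open>d\<close> cones each. Every cone of the result cuts out a lattice simplex, of volume at least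
  \<open>1 / d!\<close>.
\<close>

section \<open>Bases, cones and cells\<close>

text \<open>Costs keep the combinatorics cheap. That cones meet along common faces is never checked
  geometrically: comparing two functionals proves it. Stellar subdivision, join and refinement all
  become choices of a cost function, made with a small \<epsilon> or one large constant. The
  coefficients of the bound come from the dimension in which a point is inserted. A boundary point
  enters in dimension d and gains at least d - 1 cones; an interior point enters after the lift, in
  dimension d + 1, and gains at least d. The lift also removes an obstacle: an interior point may be
  a positive multiple of a boundary point, but distinct points at height 1 never share a ray. With b
  boundary and c interior lattice points, one of the latter being the origin, the total is at least
  2 + (d - 1) (b - d) + d (c - 1), which equals the numerator of the bound.\<close>

definition posc :: "'a::real_vector set \<Rightarrow> 'a set" where
  "posc B = {y. \<exists>\<mu>. (\<forall>v\<in>B. 0 \<le> \<mu> v) \<and> y = (\<Sum>v\<in>B. \<mu> v *\<^sub>R v)}"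

definition is_basis :: "'a::euclidean_space set \<Rightarrow> bool" where
  "is_basis B \<longleftrightarrow> independent B \<and> span B = UNIV"

text \<open>The maximal cones of the regular fan with heights \<open>h\<close>: the graph of
  \<open>f\<close> supports the points \<open>(w, h w)\<close> from below exactly along
  \<open>B\<close>, so \<open>f\<close> is a dual certificate for the optimal basis
  \<open>B\<close>. Asking for \<open>span B = span W\<close> instead of a basis of the whole space
  lets a fan live in a proper subspace, as the growth of the initial fan requires.\<close>

definition cells :: "'a::real_vector set \<Rightarrow> ('a \<Rightarrow> real) \<Rightarrow> 'a set set" where
  "cells W h = {B. B \<subseteq> W \<and> independent B \<and> span B = span W \<and>
     (\<exists>f. linear f \<and> (\<forall>v\<in>B. f v = h v) \<and> (\<forall>w\<in>W - B. f w < h w))}"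

lemma poscI: "\<lbrakk>\<And>v. v \<in> B \<Longrightarrow> 0 \<le> \<mu> v; y = (\<Sum>v\<in>B. \<mu> v *\<^sub>R v)\<rbrakk> \<Longrightarrow> y \<in> posc B"
  unfolding posc_def by blast

lemma poscE:
  assumes "y \<in> posc B"
  obtains \<mu> where "\<And>v. v \<in> B \<Longrightarrow> 0 \<le> \<mu> v" "y = (\<Sum>v\<in>B. \<mu> v *\<^sub>R v)"
  using assms unfolding posc_def by blast

lemma linear_combination:
  fixes f :: "'a::real_vector \<Rightarrow> real"
  assumes "linear f"
  shows "f (\<Sum>v\<in>B. c v *\<^sub>R v) = (\<Sum>v\<in>B. c v * f v)"
  by (simp add: linear_sum[OF assms] linear_cmul[OF assms])

section \<open>Coordinates in a basis and the exchange step\<close>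

lemma basis_finite: "is_basis B \<Longrightarrow> finite B"
  unfolding is_basis_def using finiteI_independent by blast

lemma basis_card: "is_basis B \<Longrightarrow> card B = DIM('a)" for B :: "'a::euclidean_space set"
  unfolding is_basis_def by (metis dim_UNIV dim_span dim_eq_card_independent)

lemma coord_sum: "is_basis B \<Longrightarrow> (\<Sum>v\<in>B. representation B y v *\<^sub>R v) = y"
  using basis_finite[of B] unfolding is_basis_def
  by (intro real_vector.sum_representation_eq) auto

lemma coord_linear: "is_basis B \<Longrightarrow> linear (\<lambda>y. representation B y v)"
  unfolding is_basis_def
  by (intro linearI) (simp_all add: real_vector.representation_add real_vector.representation_scale)

lemma coord_basis:
  "\<lbrakk>is_basis B; u \<in> B\<rbrakk> \<Longrightarrow> representation B u v = (if u = v then 1 else 0)"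
  unfolding is_basis_def by (auto simp: real_vector.representation_basis)

lemma coord_eqI:
  assumes "is_basis B" "y = (\<Sum>v\<in>B. c v *\<^sub>R v)" "v \<in> B"
  shows "representation B y v = c v"
proof -
  note B = assms(1)
  have "representation B y v = (\<Sum>u\<in>B. c u * representation B u v)"
    unfolding assms(2) by (rule linear_combination[OF coord_linear[OF B]])
  also have "\<dots> = (\<Sum>u\<in>B. if u = v then c u else 0)"
    by (intro sum.cong) (auto simp: coord_basis[OF B])
  also have "\<dots> = c v" using basis_finite[OF B] assms(3) by simp
  finally show ?thesis .
qed

lemma posc_basis_iff:
  assumes B: "is_basis B"
  shows "y \<in> posc B \<longleftrightarrow> (\<forall>v\<in>B. 0 \<le> representation B y v)"
proof
  assume "y \<in> posc B"
  then obtain \<mu> where "\<And>v. v \<in> B \<Longrightarrow> 0 \<le> \<mu> v" "y = (\<Sum>v\<in>B. \<mu> v *\<^sub>R v)"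
    by (rule poscE) blast
  then show "\<forall>v\<in>B. 0 \<le> representation B y v" using coord_eqI[OF B] by simp
next
  assume "\<forall>v\<in>B. 0 \<le> representation B y v"
  then show "y \<in> posc B" using coord_sum[OF B] by (intro poscI[of B "representation B y"]) auto
qed

lemma linear_coord_sum:
  fixes f :: "'a::euclidean_space \<Rightarrow> real"
  assumes "is_basis B" "linear f"
  shows "f y = (\<Sum>v\<in>B. representation B y v * f v)"
proof -
  have "f y = f (\<Sum>v\<in>B. representation B y v *\<^sub>R v)" using coord_sum[OF assms(1)] by simp
  also have "\<dots> = (\<Sum>v\<in>B. representation B y v * f v)"
    by (rule linear_combination[OF assms(2)])
  finally show ?thesis .
qed

lemma basis_exchange:
  assumes B: "is_basis B" and v: "v \<in> B" and x: "representation B x v \<noteq> 0"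
  shows "is_basis (insert x (B - {v}))"
proof -
  have ind: "independent B" using B by (simp add: is_basis_def)
  have xn: "x \<notin> span (B - {v})"
  proof
    assume "x \<in> span (B - {v})"
    then obtain c where c: "x = (\<Sum>u\<in>B - {v}. c u *\<^sub>R u)"
      using basis_finite[OF B] by (auto simp: span_finite)
    have "x = (\<Sum>u\<in>B. (if u = v then 0 else c u) *\<^sub>R u)"
      unfolding c by (rule sum.mono_neutral_cong_left) (use basis_finite[OF B] in auto)
    from coord_eqI[OF B this v] x show False by simp
  qed
  have i: "independent (insert x (B - {v}))"
    by (rule independent_insertI[OF xn independent_mono[OF ind Diff_subset]])
  have "x \<notin> B - {v}" using xn span_base[of x "B - {v}"] by argo
  then have "card (insert x (B - {v})) = card B"
    using card.remove[OF basis_finite[OF B] v] card_insert_disjoint[of "B - {v}" x] basis_finite[OF B]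
    by simp
  then have "card (insert x (B - {v})) = DIM('a)" using basis_card[OF B] by simp
  then have "UNIV \<subseteq> span (insert x (B - {v}))"
    by (intro card_ge_dim_independent i) auto
  then show ?thesis using i by (auto simp: is_basis_def)
qed

text \<open>The pivot: \<open>t\<close> matches \<open>y\<close> with \<open>t *\<^sub>R x\<close>
  at \<open>v0\<close>, so subtracting this multiple removes \<open>v0\<close> from the expansion.
  It serves both the covering by a stellar subdivision and the simplex method.\<close>

lemma exchange_combination:
  assumes b: "is_basis B" and v0: "v0 \<in> B" "representation B y v0 = t * representation B x v0"
  shows "y = t *\<^sub>R x + (\<Sum>v\<in>B - {v0}. (representation B y v - t * representation B x v) *\<^sub>R v)"
proof -
  have "y - t *\<^sub>R x = (\<Sum>v\<in>B. (representation B y v - t * representation B x v) *\<^sub>R v)"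
    using coord_sum[OF b, of y] coord_sum[OF b, of x]
    by (simp add: scaleR_left_diff_distrib sum_subtractf scaleR_sum_right[symmetric] flip: scaleR_scaleR)
  also have "\<dots> = (\<Sum>v\<in>B - {v0}. (representation B y v - t * representation B x v) *\<^sub>R v)"
    by (rule sum.mono_neutral_right) (use basis_finite[OF b] v0 in auto)
  finally show ?thesis by (simp add: algebra_simps)
qed

lemma posc_exchange:
  assumes b: "is_basis B" and v0: "v0 \<in> B" "representation B y v0 = t * representation B x v0"
    and t: "0 \<le> t" and xB: "x \<notin> B"
    and nn: "\<And>v. v \<in> B \<Longrightarrow> t * representation B x v \<le> representation B y v"
  shows "y \<in> posc (insert x (B - {v0}))"
proof (rule poscI)
  let ?d = "\<lambda>v. representation B y v - t * representation B x v"
  let ?c = "\<lambda>v. if v = x then t else ?d v"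
  show "0 \<le> ?c v" if "v \<in> insert x (B - {v0})" for v using that t nn by auto
  have "(\<Sum>v\<in>insert x (B - {v0}). ?c v *\<^sub>R v) = ?c x *\<^sub>R x + (\<Sum>v\<in>B - {v0}. ?c v *\<^sub>R v)"
    by (rule sum.insert) (use basis_finite[OF b] xB in auto)
  also have "(\<Sum>v\<in>B - {v0}. ?c v *\<^sub>R v) = (\<Sum>v\<in>B - {v0}. ?d v *\<^sub>R v)"
    by (rule sum.cong) (use xB in auto)
  finally show "y = (\<Sum>v\<in>insert x (B - {v0}). ?c v *\<^sub>R v)"
    using exchange_combination[OF b v0] by simp
qed

section \<open>Cells of a cost function\<close>

lemma cells_basis:
  "\<lbrakk>B \<in> cells W h; span W = UNIV\<rbrakk> \<Longrightarrow> is_basis B"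
  by (simp add: cells_def is_basis_def)

lemma cells_subset: "B \<in> cells W h \<Longrightarrow> B \<subseteq> W"
  by (simp add: cells_def)

lemma finite_cells: "finite W \<Longrightarrow> finite (cells W h)"
  by (rule finite_subset[of _ "Pow W"]) (auto simp: cells_def)

lemma cellsE:
  assumes "B \<in> cells W h"
  obtains f where "linear f" "\<And>v. v \<in> B \<Longrightarrow> f v = h v" "\<And>w. w \<in> W - B \<Longrightarrow> f w < h w"
  using assms unfolding cells_def by blast

lemma cellsI:
  assumes "is_basis B" "B \<subseteq> W" "linear f" "\<And>v. v \<in> B \<Longrightarrow> f v = h v"
    "\<And>w. w \<in> W - B \<Longrightarrow> f w < h w"
  shows "B \<in> cells W h"
proof -
  have "span W = UNIV" using assms(1,2) span_mono[of B W] by (auto simp: is_basis_def)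
  then show ?thesis using assms by (auto simp: cells_def is_basis_def)
qed

text \<open>Each functional below is a lower bound for the other cost, and strictly so away from a common
  face, so a point common to two cones has its support in both.\<close>

lemma cells_common_support:
  assumes "B \<in> cells W h" "B' \<in> cells W h" "finite W"
    and y: "y = (\<Sum>v\<in>B. \<mu> v *\<^sub>R v)" "\<And>v. v \<in> B \<Longrightarrow> 0 \<le> \<mu> v" and y': "y \<in> posc B'"
  shows "\<And>v. v \<in> B \<Longrightarrow> \<mu> v \<noteq> 0 \<Longrightarrow> v \<in> B'"
proof (rule ccontr)
  fix v0 assume v0: "v0 \<in> B" "\<mu> v0 \<noteq> 0" "v0 \<notin> B'"
  obtain f where f: "linear f" "\<And>v. v \<in> B \<Longrightarrow> f v = h v" "\<And>w. w \<in> W - B \<Longrightarrow> f w < h w"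
    by (rule cellsE[OF assms(1)]) blast
  obtain g where g: "linear g" "\<And>v. v \<in> B' \<Longrightarrow> g v = h v" "\<And>w. w \<in> W - B' \<Longrightarrow> g w < h w"
    by (rule cellsE[OF assms(2)]) blast
  obtain \<nu> where \<nu>: "\<And>v. v \<in> B' \<Longrightarrow> 0 \<le> \<nu> v" "y = (\<Sum>v\<in>B'. \<nu> v *\<^sub>R v)"
    by (rule poscE[OF y']) blast
  have sub: "B \<subseteq> W" "B' \<subseteq> W" using assms(1,2) cells_subset by auto
  have fin: "finite B" using assms(3) sub finite_subset by auto
  have "f y = (\<Sum>v\<in>B'. \<nu> v * f v)" unfolding \<nu>(2) by (rule linear_combination[OF f(1)])
  also have "\<dots> \<le> (\<Sum>v\<in>B'. \<nu> v * g v)"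
    by (intro sum_mono mult_left_mono) (use \<nu> f g sub in \<open>force+\<close>)
  also have "\<dots> = g y" unfolding \<nu>(2) by (rule linear_combination[OF g(1), symmetric])
  also have "\<dots> = (\<Sum>v\<in>B. \<mu> v * g v)" unfolding y(1) by (rule linear_combination[OF g(1)])
  also have "\<dots> < (\<Sum>v\<in>B. \<mu> v * f v)"
  proof (rule sum_strict_mono_ex1[OF fin])
    show "\<forall>v\<in>B. \<mu> v * g v \<le> \<mu> v * f v"
      by (intro ballI mult_left_mono) (use y(2) f g sub in \<open>force+\<close>)
    have "g v0 < f v0" using v0 f(2) g(3) sub by auto
    then show "\<exists>v\<in>B. \<mu> v * g v < \<mu> v * f v"
      using v0 y(2) by (intro bexI[of _ v0] mult_strict_left_mono) (auto simp: less_le)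
  qed
  also have "\<dots> = f y" unfolding y(1) by (rule linear_combination[OF f(1), symmetric])
  finally show False by simp
qed

text \<open>A greedy transversal: before each choice fewer vectors have been picked than
  \<open>A i\<close> contains, so their span cannot swallow the independent set
  \<open>A i\<close>.\<close>

lemma independent_choice:
  assumes "finite I" "\<And>i. i \<in> I \<Longrightarrow> independent (A i) \<and> card I \<le> card (A i)"
  shows "\<exists>c. (\<forall>i\<in>I. c i \<in> (A i :: 'a::euclidean_space set)) \<and> independent (c ` I)"
  using assms
proof (induction I rule: finite_induct)
  case empty
  show ?case by (simp add: independent_empty)
next
  case (insert i I)
  obtain c where c: "\<forall>j\<in>I. c j \<in> A j" "independent (c ` I)"
    using insert.IH insert.prems insert.hyps by force
  have "\<exists>a\<in>A i. a \<notin> span (c ` I)"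
  proof (rule ccontr)
    assume "\<not> ?thesis"
    then have "A i \<subseteq> span (c ` I)" by blast
    then have "card (A i) \<le> card (c ` I)"
      using insert.prems insert.hyps
      by (metis c(2) dim_eq_card_independent dim_span dim_subset insertI1)
    also have "\<dots> \<le> card I" using insert.hyps card_image_le by blast
    finally show False using insert.prems[of i] insert.hyps by simp
  qed
  then obtain a where a: "a \<in> A i" "a \<notin> span (c ` I)" by blast
  have "(c(i := a)) ` insert i I = insert a (c ` I)" using insert.hyps by auto
  moreover have "independent (insert a (c ` I))" using a c by (simp add: independent_insert)
  ultimately have "independent ((c(i := a)) ` insert i I)" by simp
  then show ?case using a c insert.hyps by (intro exI[of _ "c(i := a)"]) auto
qed

lemma linear_functional_inner:
  fixes f :: "'a::euclidean_space \<Rightarrow> real"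
  assumes "linear f"
  shows "f y = (\<Sum>b\<in>Basis. f b *\<^sub>R b) \<bullet> y"
proof -
  have "f y = f (\<Sum>b\<in>Basis. (y \<bullet> b) *\<^sub>R b)" by (simp add: euclidean_representation)
  also have "\<dots> = (\<Sum>b\<in>Basis. (y \<bullet> b) * f b)"
    by (rule linear_combination[OF assms])
  also have "\<dots> = (\<Sum>b\<in>Basis. f b *\<^sub>R b) \<bullet> y"
    unfolding inner_sum_left by (intro sum.cong) (simp_all add: inner_commute)
  finally show ?thesis .
qed

lemma functional_conditions:
  assumes "independent A" "finite A"
  shows "\<exists>y::'a::euclidean_space. \<forall>a\<in>A. a \<bullet> y = r a"
proof -
  obtain g where g: "linear g" "\<And>a. a \<in> A \<Longrightarrow> g a = r a"
    using linear_independent_extend[OF assms(1), of r] by blast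
  have "a \<bullet> (\<Sum>b\<in>Basis. g b *\<^sub>R b) = r a" if "a \<in> A" for a
    using g(2)[OF that] linear_functional_inner[OF g(1), of a] by (metis inner_commute)
  then show ?thesis by blast
qed

text \<open>If few cones contained \<open>x\<close>, one could pick for each of them a facet through \<open>x\<close> with all picked
  normals independent, and leave every cone at once by moving \<open>x\<close> across all these facets.\<close>

lemma card_cones_through_face:
  fixes x :: "'a::euclidean_space"
  assumes T: "finite T" "\<And>B. B \<in> T \<Longrightarrow> is_basis B"
    and x: "x \<in> interior K" and K: "K \<subseteq> (\<Union>B\<in>T. posc B)"
    and F: "\<And>B. B \<in> T \<Longrightarrow> x \<in> posc B \<Longrightarrow> F \<subseteq> B \<and> (\<forall>v\<in>B - F. representation B x v = 0)"
  shows "DIM('a) - card F < card {B\<in>T. x \<in> posc B}"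
proof (rule ccontr)
  define Tx where "Tx = {B\<in>T. x \<in> posc B}"
  assume "\<not> ?thesis"
  then have m: "card Tx \<le> DIM('a) - card F" by (simp add: Tx_def)
  \<comment> \<open>The gradient of the coordinate at \<open>v\<close>, that is, the inner normal of
    the facet of \<open>posc B\<close> opposite \<open>v\<close>. For \<open>v\<close> in
    \<open>B - F\<close> this facet passes through \<open>x\<close>.\<close>
  define nv where "nv B v = (\<Sum>b\<in>Basis. representation B b v *\<^sub>R b)" for B and v :: 'a
  have nv: "nv B v \<bullet> y = representation B y v" if "is_basis B" for B v y
    using linear_functional_inner[OF coord_linear[OF that], of y v] by (simp add: nv_def)
  have fin: "finite Tx" using T by (simp add: Tx_def)
  have *: "independent (nv B ` (B - F)) \<and> card Tx \<le> card (nv B ` (B - F))" if "B \<in> Tx" for B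
  proof -
    have B: "is_basis B" "F \<subseteq> B" using that T F by (auto simp: Tx_def)
    have inj: "inj_on (nv B) B"
    proof
      fix u v assume uv: "u \<in> B" "v \<in> B" "nv B u = nv B v"
      then have "representation B u u = representation B u v" using nv[OF B(1)] by metis
      then show "u = v" using coord_basis[OF B(1) uv(1)] by (auto split: if_splits)
    qed
    have "independent (nv B ` B)"
    proof (rule independent_if_scalars_zero)
      show "finite (nv B ` B)" using basis_finite[OF B(1)] by simp
      fix f a assume s: "(\<Sum>x\<in>nv B ` B. f x *\<^sub>R x) = 0" and a: "a \<in> nv B ` B"
      then obtain v where v: "v \<in> B" "a = nv B v" by blast
      have "(\<Sum>u\<in>B. f (nv B u) *\<^sub>R nv B u) = 0" using s by (simp add: sum.reindex[OF inj])
      then have "0 = (\<Sum>u\<in>B. f (nv B u) *\<^sub>R nv B u) \<bullet> v" by simp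
      also have "\<dots> = (\<Sum>u\<in>B. if u = v then f (nv B u) else 0)"
        unfolding inner_sum_left by (intro sum.cong) (auto simp: nv[OF B(1)] coord_basis[OF B(1) v(1)])
      also have "\<dots> = f a" using v basis_finite[OF B(1)] by simp
      finally show "f a = 0" by simp
    qed
    moreover have "card (nv B ` (B - F)) = DIM('a) - card F"
      using inj B basis_card[OF B(1)] basis_finite[OF B(1)]
      by (metis Diff_subset card_Diff_subset card_image finite_subset inj_on_subset)
    ultimately show ?thesis using m
      by (metis Diff_subset image_mono independent_mono)
  qed
  obtain c where c: "\<forall>B\<in>Tx. c B \<in> nv B ` (B - F)" "independent (c ` Tx)"
    using independent_choice[OF fin, of "\<lambda>B. nv B ` (B - F)"] * by blast
  \<comment> \<open>In every cone containing \<open>x\<close> the chosen coordinate vanishes at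
    \<open>x\<close> and decreases along \<open>y\<close>, so a small step leaves all these cones.
    The other cones are closed and stay avoided, which contradicts the covering of
    \<open>K\<close>.\<close>
  obtain y where y: "\<forall>a\<in>c ` Tx. a \<bullet> y = -1"
    using functional_conditions[OF c(2), of "\<lambda>_. -1"] fin by auto
  have "\<forall>\<^sub>F \<epsilon> in at_right 0. x + \<epsilon> *\<^sub>R y \<notin> posc B" if B: "B \<in> T" for B
  proof (cases "B \<in> Tx")
    case True
    then obtain v where v: "v \<in> B - F" "c B = nv B v" using c by blast
    have b: "is_basis B" using T B by blast
    have "representation B x v = 0" using F[OF B] True v by (auto simp: Tx_def)
    moreover have "representation B y v = -1" using y True v nv[OF b] by force
    ultimately have neg: "representation B (x + \<epsilon> *\<^sub>R y) v = - \<epsilon>" for \<epsilon>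
      by (simp add: linear_add[OF coord_linear[OF b]] linear_cmul[OF coord_linear[OF b]])
    show ?thesis
      using eventually_at_right_less[of 0]
    proof eventually_elim
      case (elim \<epsilon>)
      then show ?case using neg[of \<epsilon>] v posc_basis_iff[OF b] by force
    qed
  next
    case False
    have b: "is_basis B" using T B by blast
    obtain v where v: "v \<in> B" "representation B x v < 0"
      using False B posc_basis_iff[OF b] by (auto simp: Tx_def not_le)
    have "((\<lambda>\<epsilon>. representation B x v + \<epsilon> * representation B y v) \<longlongrightarrow>
      representation B x v + 0 * representation B y v) (at_right 0)"
      by (intro tendsto_intros)
    then have "\<forall>\<^sub>F \<epsilon> in at_right 0. representation B x v + \<epsilon> * representation B y v < 0"
      using v by (intro order_tendstoD) auto
    then show ?thesis
    proof eventually_elim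
      case (elim \<epsilon>)
      then have "representation B (x + \<epsilon> *\<^sub>R y) v < 0"
        by (simp add: linear_add[OF coord_linear[OF b]] linear_cmul[OF coord_linear[OF b]])
      then show ?case using v posc_basis_iff[OF b] by force
    qed
  qed
  then have "\<forall>\<^sub>F \<epsilon> in at_right 0. \<forall>B\<in>T. x + \<epsilon> *\<^sub>R y \<notin> posc B"
    using T by (simp add: eventually_ball_finite)
  moreover have "\<forall>\<^sub>F \<epsilon> in at_right 0. x + \<epsilon> *\<^sub>R y \<in> interior K"
  proof -
    have "((\<lambda>\<epsilon>. x + \<epsilon> *\<^sub>R y) \<longlongrightarrow> x + 0 *\<^sub>R y) (at_right 0)" by (intro tendsto_intros)
    then show ?thesis using x by (auto elim: topological_tendstoD)
  qed
  ultimately have "\<forall>\<^sub>F \<epsilon> in at_right (0::real). False"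
  proof eventually_elim
    case (elim \<epsilon>)
    then show ?case using K interior_subset[of K] by blast
  qed
  then show False by simp
qed

section \<open>Inserting a generator\<close>

lemma eventually_at_right_0_less:
  fixes a b c :: real
  assumes "a < b"
  shows "\<forall>\<^sub>F \<epsilon> in at_right 0. a + \<epsilon> * c < b"
proof -
  have "((\<lambda>\<epsilon>. a + \<epsilon> * c) \<longlongrightarrow> a + 0 * c) (at_right 0)" by (intro tendsto_intros)
  then show ?thesis using assms by (intro order_tendstoD) auto
qed

lemma finite_obtain_min:
  fixes r :: "'b \<Rightarrow> real"
  assumes "finite S" "S \<noteq> {}"
  obtains s where "s \<in> S" "\<And>u. u \<in> S \<Longrightarrow> r s \<le> r u"
proof -
  have "Min (r ` S) \<in> r ` S" using assms by (intro Min_in) auto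
  then obtain s where "s \<in> S" "r s = Min (r ` S)" by auto
  then show thesis using that assms by simp
qed

text \<open>The minimum ratio rule: \<open>t\<close> is the largest multiple of \<gamma> that can be
  subtracted from \<alpha> without creating a negative entry, and \<open>m\<close> is an entry that
  becomes zero. It drives pivots, the reduction of conic combinations and the minimality of
  circuits.\<close>

lemma ratio_test:
  fixes \<alpha> \<gamma> :: "'b \<Rightarrow> real"
  assumes "finite C" "\<And>c. c \<in> C \<Longrightarrow> 0 \<le> \<alpha> c" "c1 \<in> C" "0 < \<gamma> c1"
  obtains m t where "m \<in> C" "0 < \<gamma> m" "\<alpha> m = t * \<gamma> m" "0 \<le> t" "\<And>c. c \<in> C \<Longrightarrow> t * \<gamma> c \<le> \<alpha> c"
proof -
  let ?P = "{c\<in>C. 0 < \<gamma> c}"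
  have "finite ?P" "?P \<noteq> {}" using assms by auto
  then obtain m where m: "m \<in> ?P" "\<And>u. u \<in> ?P \<Longrightarrow> \<alpha> m / \<gamma> m \<le> \<alpha> u / \<gamma> u"
    using finite_obtain_min[of ?P "\<lambda>u. \<alpha> u / \<gamma> u"] by blast
  define t where "t = \<alpha> m / \<gamma> m"
  have t: "0 \<le> t" using m(1) assms(2) by (simp add: t_def)
  have "t * \<gamma> c \<le> \<alpha> c" if "c \<in> C" for c
  proof (cases "0 < \<gamma> c")
    case True
    then show ?thesis using m(2)[of c] that by (simp add: t_def pos_le_divide_eq)
  next
    case False
    then have "t * \<gamma> c \<le> 0" using t by (simp add: mult_nonneg_nonpos)
    then show ?thesis using assms(2)[OF that] by simp
  qed
  moreover have "\<alpha> m = t * \<gamma> m" using m(1) by (simp add: t_def)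
  ultimately show thesis using that m(1) t by blast
qed

text \<open>Giving the new generator \<open>x\<close> a cost just below the cost that the old cells assign to it
  produces the stellar subdivision at \<open>x\<close>: each cone containing \<open>x\<close> is replaced by the cones in which
  \<open>x\<close> takes the place of a vertex of the face \<open>F\<close> carrying \<open>x\<close>.\<close>

lemma cells_insert:
  fixes x :: "'a::euclidean_space"
  assumes W: "finite W" "span W = UNIV" and hpos: "\<And>w. w \<in> W \<Longrightarrow> 0 < h w"
    and ray: "\<And>w t. w \<in> W \<Longrightarrow> 0 \<le> t \<Longrightarrow> x \<noteq> t *\<^sub>R w"
    and x: "x \<in> interior K" and K: "K \<subseteq> (\<Union>B\<in>cells W h. posc B)"
  shows "\<exists>h'. (\<forall>w\<in>insert x W. 0 < h' w) \<and> K \<subseteq> (\<Union>B\<in>cells (insert x W) h'. posc B) \<and>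
    card (cells W h) + DIM('a) - 1 \<le> card (cells (insert x W) h')"
proof -
  define T where "T = cells W h"
  define Tx where "Tx = {B\<in>T. x \<in> posc B}"
  have bas: "is_basis B" if "B \<in> T" for B using that cells_basis W by (auto simp: T_def)
  have sub: "B \<subseteq> W" if "B \<in> T" for B using that cells_subset by (auto simp: T_def)
  have finT: "finite T" "finite Tx" using finite_cells[OF W(1)] by (auto simp: T_def Tx_def)
  have xW: "x \<notin> W" using ray[of x 1] by auto
  have "W \<noteq> {}" using W(2) by (metis UNIV_not_singleton span_empty)
  then have x0: "x \<noteq> 0" using ray[of _ 0] by auto
  obtain B0 where B0: "B0 \<in> T" "x \<in> posc B0"
    using x K interior_subset[of K] by (auto simp: T_def)
  define l where "l = representation B0 x"
  \<comment> \<open>The support of \<open>x\<close> in one cone. By \<open>FB\<close> and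
    \<open>rep\<close> below it is the support in every cone that contains \<open>x\<close>, hence
    the face carrying \<open>x\<close>.\<close>
  define F where "F = {v\<in>B0. l v \<noteq> 0}"
  have finF: "finite F" using basis_finite[OF bas[OF B0(1)]] by (simp add: F_def)
  have lpos: "0 < l v" if "v \<in> F" for v
    using that B0(2) posc_basis_iff[OF bas[OF B0(1)]] by (force simp: F_def l_def)
  have xF: "x = (\<Sum>v\<in>F. l v *\<^sub>R v)"
  proof -
    have "x = (\<Sum>v\<in>B0. l v *\<^sub>R v)" using coord_sum[OF bas[OF B0(1)]] by (simp add: l_def)
    also have "\<dots> = (\<Sum>v\<in>F. l v *\<^sub>R v)"
      by (rule sum.mono_neutral_right) (use basis_finite[OF bas[OF B0(1)]] in \<open>auto simp: F_def\<close>)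
    finally show ?thesis .
  qed
  have FB: "F \<subseteq> B" if "B \<in> Tx" for B
  proof
    fix v assume v: "v \<in> F"
    have x_eq: "x = (\<Sum>v\<in>B0. l v *\<^sub>R v)" using coord_sum[OF bas[OF B0(1)]] by (simp add: l_def)
    have nn: "0 \<le> l v" if "v \<in> B0" for v
      using that B0(2) posc_basis_iff[OF bas[OF B0(1)]] by (auto simp: l_def)
    show "v \<in> B"
      using cells_common_support[OF _ _ W(1) x_eq nn] that B0(1) v by (auto simp: T_def Tx_def F_def)
  qed
  have rep: "representation B x v = (if v \<in> F then l v else 0)" if "F \<subseteq> B" "B \<in> T" "v \<in> B" for B v
  proof (rule coord_eqI[OF bas[OF that(2)] _ that(3)])
    show "x = (\<Sum>v\<in>B. (if v \<in> F then l v else 0) *\<^sub>R v)"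
      unfolding xF using basis_finite[OF bas[OF that(2)]] that
      by (intro sum.mono_neutral_cong_left) auto
  qed
  have TxI: "B \<in> Tx" if "F \<subseteq> B" "B \<in> T" for B
    unfolding Tx_def using that rep[OF that] lpos posc_basis_iff[OF bas[OF that(2)], of x]
    by (auto intro: less_imp_le)
  have F2: "2 \<le> card F"
  proof (rule ccontr)
    assume "\<not> 2 \<le> card F"
    then have "card F = 0 \<or> card F = 1" by linarith
    then consider "F = {}" | v where "F = {v}" using finF by (auto simp: card_1_singleton_iff)
    then show False
    proof cases
      case 1
      then show False using xF x0 by simp
    next
      case 2
      then have "x = l v *\<^sub>R v" "v \<in> W" using xF FB[of B0] sub[OF B0(1)] B0 by (auto simp: Tx_def)
      then show False using ray[of v "l v"] lpos[of v] 2 by auto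
    qed
  qed
  have Fne: "F \<noteq> {}" using F2 by auto
  have FW: "F \<subseteq> W" using B0 sub by (auto simp: F_def)
  have "\<forall>B\<in>T. \<exists>f. linear f \<and> (\<forall>v\<in>B. f v = h v) \<and> (\<forall>w\<in>W - B. f w < h w)"
    by (auto simp: T_def cells_def)
  then obtain f where f: "\<And>B. B \<in> T \<Longrightarrow> linear (f B)" "\<And>B v. B \<in> T \<Longrightarrow> v \<in> B \<Longrightarrow> f B v = h v"
    "\<And>B w. B \<in> T \<Longrightarrow> w \<in> W - B \<Longrightarrow> f B w < h w"
    by metis
  \<comment> \<open>The value at \<open>x\<close> of the functional of every cell whose cone
    contains \<open>x\<close>; the functionals of all other cells are strictly smaller
    there.\<close>
  define g where "g = (\<Sum>v\<in>F. l v * h v)"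
  have gpos: "0 < g" unfolding g_def
    by (intro sum_pos) (use finF Fne lpos hpos FW in auto)
  have fx: "f B x = (\<Sum>v\<in>F. l v * f B v)" if "B \<in> T" for B
    by (subst xF) (rule linear_combination[OF f(1)[OF that]])
  have fTx: "f B x = g" if "B \<in> Tx" for B
    unfolding g_def using fx[of B] f(2)[of B] FB[OF that] that
    by (auto simp: Tx_def subset_iff intro!: sum.cong)
  have fnT: "f B x < g" if "B \<in> T - Tx" for B
  proof -
    have "\<not> F \<subseteq> B" using TxI[of B] that by blast
    then obtain v where v: "v \<in> F" "v \<notin> B" by blast
    have "(\<Sum>v\<in>F. l v * f B v) < (\<Sum>v\<in>F. l v * h v)"
    proof (rule sum_strict_mono_ex1[OF finF])
      show "\<forall>v\<in>F. l v * f B v \<le> l v * h v"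
        using f(2,3)[of B] that FW lpos by (auto intro!: mult_left_mono simp: less_imp_le subset_iff)
          (metis less_eq_real_def)
      show "\<exists>v\<in>F. l v * f B v < l v * h v"
        using v f(3)[of B v] that FW lpos by (intro bexI[of _ v]) auto
    qed
    then show ?thesis using fx that by (simp add: g_def)
  qed
  have "\<forall>\<^sub>F \<epsilon> in at_right 0. 0 < \<epsilon> \<and> \<epsilon> < g \<and> (\<forall>B\<in>T - Tx. f B x + \<epsilon> < g) \<and>
     (\<forall>B\<in>Tx. \<forall>v\<in>F. \<forall>w\<in>W - B. f B w + \<epsilon> * - (representation B w v / l v) < h w)"
    (is "eventually ?P _")
  proof (intro eventually_conj)
    show "\<forall>\<^sub>F \<epsilon> in at_right 0. (0::real) < \<epsilon>" by (simp add: eventually_at_right_less)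
    show "\<forall>\<^sub>F \<epsilon> in at_right 0. \<epsilon> < g" using eventually_at_right_0_less[OF gpos, of 1] by simp
    have "\<forall>B\<in>T - Tx. \<forall>\<^sub>F \<epsilon> in at_right 0. f B x + \<epsilon> < g"
      using eventually_at_right_0_less[OF fnT, of _ 1] by simp
    then show "\<forall>\<^sub>F \<epsilon> in at_right 0. \<forall>B\<in>T - Tx. f B x + \<epsilon> < g"
      using finT by (intro eventually_ball_finite) auto
    show "\<forall>\<^sub>F \<epsilon> in at_right 0.
       \<forall>B\<in>Tx. \<forall>v\<in>F. \<forall>w\<in>W - B. f B w + \<epsilon> * - (representation B w v / l v) < h w"
    proof (intro eventually_ball_finite ballI)
      fix B v w assume "B \<in> Tx" "v \<in> F" "w \<in> W - B"
      then show "\<forall>\<^sub>F \<epsilon> in at_right 0. f B w + \<epsilon> * - (representation B w v / l v) < h w"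
        using f(3)[of B w] by (intro eventually_at_right_0_less) (auto simp: Tx_def)
    qed (use finT finF W in auto)
  qed
  then obtain \<epsilon> where \<epsilon>: "?P \<epsilon>" using eventually_happens'[OF trivial_limit_at_right_real] by blast
  \<comment> \<open>By the choice of \<epsilon> the cost of \<open>x\<close> stays positive and
    above the functionals of the cells avoiding \<open>x\<close>, which therefore survive, while the
    tilted functionals of the new cells stay below the old costs.\<close>
  define h' where "h' = h(x := g - \<epsilon>)"
  define T' where "T' = cells (insert x W) h'"
  define nw where "nw = (\<lambda>(B, v). insert x (B - {v::'a}))"
  have old: "B \<in> T'" if B: "B \<in> T - Tx" for B
    unfolding T'_def
  proof (rule cellsI)
    show "is_basis B" "B \<subseteq> insert x W" "linear (f B)" using B bas sub f by auto
    show "f B v = h' v" if "v \<in> B" for v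
      using that B f(2)[of B v] sub[of B] xW by (auto simp: h'_def)
    show "f B w < h' w" if "w \<in> insert x W - B" for w
      using that B f(3)[of B w] \<epsilon> by (auto simp: h'_def algebra_simps)
  qed
  have new: "nw (B, v) \<in> T'" if B: "B \<in> Tx" and v: "v \<in> F" for B v
    unfolding T'_def
  proof (rule cellsI)
    have BT: "B \<in> T" and vB: "v \<in> B" using that FB by (auto simp: Tx_def)
    note b = bas[OF BT]
    have rx: "representation B x v = l v" using rep[OF FB[OF B] BT vB] v by simp
    show "is_basis (nw (B, v))"
      using basis_exchange[OF b vB, of x] rx lpos[OF v] by (simp add: nw_def)
    show "nw (B, v) \<subseteq> insert x W" using sub[OF BT] by (auto simp: nw_def)
    \<comment> \<open>The tilt vanishes on \<open>B - {v}\<close> and lowers the value at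
      \<open>x\<close> by exactly \<epsilon>, because the coordinate of \<open>x\<close> at
      \<open>v\<close> is \<open>l v\<close>. At the removed point \<open>v\<close> it lowers the
      value by \<epsilon> / \<open>l v\<close>, which gives the strict inequality there.\<close>
    let ?f = "\<lambda>y. f B y + \<epsilon> * - (representation B y v / l v)"
    show "linear ?f"
      by (intro linearI) (simp_all add: linear_add[OF f(1)[OF BT]] linear_add[OF coord_linear[OF b]]
        linear_cmul[OF f(1)[OF BT]] linear_cmul[OF coord_linear[OF b]] algebra_simps add_divide_distrib)
    show "?f u = h' u" if "u \<in> nw (B, v)" for u
    proof (cases "u = x")
      case True
      then show ?thesis using fTx[OF B] rx lpos[OF v] by (simp add: h'_def)
    next
      case False
      then have "u \<in> B" "u \<noteq> v" using that by (auto simp: nw_def)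
      then show ?thesis using f(2)[OF BT] coord_basis[OF b, of u v] False by (simp add: h'_def)
    qed
    show "?f w < h' w" if "w \<in> insert x W - nw (B, v)" for w
    proof (cases "w = v")
      case True
      then have "w \<noteq> x" using vB sub[OF BT] xW by auto
      moreover have "0 < \<epsilon> * (1 / l v)" using lpos[OF v] \<epsilon> by simp
      ultimately show ?thesis
        using True f(2)[OF BT vB] coord_basis[OF b vB, of v] by (simp add: h'_def)
    next
      case False
      then have "w \<in> W - B" "w \<noteq> x" using that xW by (auto simp: nw_def)
      then show ?thesis using \<epsilon> B v by (simp add: h'_def)
    qed
  qed
  have inj: "inj_on nw (Tx \<times> F)"
  proof (intro inj_onI, clarsimp)
    fix B v B' v' assume a: "B \<in> Tx" "v \<in> F" "B' \<in> Tx" "v' \<in> F" "nw (B, v) = nw (B', v')"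
    have "x \<notin> B" "x \<notin> B'" using a sub xW by (auto simp: Tx_def)
    then have e: "B - {v} = B' - {v'}" using a(5) by (auto simp: nw_def)
    have "v \<in> B'" "v' \<in> B" "v \<in> B" "v' \<in> B'" using a FB by auto
    then show "B = B' \<and> v = v'" using e by blast
  qed
  have xnw: "x \<in> nw p" for p by (cases p) (simp add: nw_def)
  have fT': "finite T'" using finite_cells[of "insert x W"] W(1) by (simp add: T'_def)
  have "card (T - Tx) + card Tx * card F = card ((T - Tx) \<union> nw ` (Tx \<times> F))"
  proof (subst card_Un_disjoint)
    show "(T - Tx) \<inter> nw ` (Tx \<times> F) = {}" using sub xW xnw by blast
  qed (use finT finF card_image[OF inj] in \<open>auto simp: card_cartesian_product\<close>)
  also have "\<dots> \<le> card T'"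
    by (rule card_mono[OF fT']) (use old new in auto)
  finally have c1: "card (T - Tx) + card Tx * card F \<le> card T'" .
  have "card Tx \<le> card T" using finT by (intro card_mono) (auto simp: Tx_def)
  moreover have "card (T - Tx) = card T - card Tx"
    using finT by (intro card_Diff_subset) (auto simp: Tx_def)
  ultimately have c2: "card T = card (T - Tx) + card Tx" by simp
  have c3: "DIM('a) - card F < card Tx"
    unfolding Tx_def
  proof (rule card_cones_through_face[OF finT(1) bas x])
    show "K \<subseteq> (\<Union>B\<in>T. posc B)" using K by (simp add: T_def)
    fix B assume "B \<in> T" "x \<in> posc B"
    then show "F \<subseteq> B \<and> (\<forall>v\<in>B - F. representation B x v = 0)"
      using FB[of B] rep[of B] by (auto simp: Tx_def)
  qed auto
  have c4: "card F \<le> DIM('a)"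
    using card_mono[OF basis_finite[OF bas[OF B0(1)]], of F] basis_card[OF bas[OF B0(1)]]
    by (auto simp: F_def)
  \<comment> \<open>Replacing \<open>card Tx\<close> cones by \<open>card Tx * card F\<close> gains
    \<open>card Tx * (card F - 1)\<close>. Writing \<open>card F = p + 2\<close> and the dimension
    as \<open>p + q + 2\<close> avoids truncated subtraction: the gain is at least
    \<open>(q + 1) * (p + 1)\<close>, and this is at least \<open>p + q + 1\<close>, one less than
    the dimension.\<close>
  define p q where "p = card F - 2" and "q = DIM('a) - card F"
  have pq: "card F = p + 2" "DIM('a) = p + q + 2" "q + 1 \<le> card Tx"
    using F2 c3 c4 by (auto simp: p_def q_def)
  have "p + q + 1 \<le> (q + 1) * (p + 1)" by (simp add: algebra_simps)
  also have "\<dots> \<le> card Tx * (p + 1)" using pq(3) by (intro mult_right_mono) auto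
  finally have c5: "p + q + 1 \<le> card Tx * (p + 1)" .
  have count: "card T + DIM('a) - 1 \<le> card T'"
    using c1 c2 c5 by (simp add: pq algebra_simps)
  have cover: "K \<subseteq> (\<Union>B\<in>T'. posc B)"
  proof
    fix y assume "y \<in> K"
    then obtain B where B: "B \<in> T" "y \<in> posc B" using K by (auto simp: T_def)
    show "y \<in> (\<Union>B\<in>T'. posc B)"
    proof (cases "B \<in> Tx")
      case False
      then show ?thesis using old B by auto
    next
      case True
      note b = bas[OF B(1)]
      let ?m = "representation B y"
      have m: "0 \<le> ?m v" if "v \<in> B" for v using B(2) that posc_basis_iff[OF b] by auto
      let ?r = "representation B x"
      \<comment> \<open>Travelling from \<open>y\<close> in the direction \<open>- x\<close>, one
        leaves \<open>posc B\<close> through the facet opposite some \<open>v0\<close>. Since the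
        coordinate of \<open>x\<close> at \<open>v0\<close> is positive, \<open>v0\<close> lies in
        \<open>F\<close>, so exchanging it for \<open>x\<close> gives one of the new cells.\<close>
      obtain v1 where v1: "v1 \<in> F" using Fne by blast
      then have "v1 \<in> B" "0 < ?r v1" using FB[OF True] rep[OF FB[OF True] B(1)] lpos by auto
      then obtain v0 t where v0: "v0 \<in> B" "0 < ?r v0" "?m v0 = t * ?r v0" "0 \<le> t"
        and nn: "\<And>v. v \<in> B \<Longrightarrow> t * ?r v \<le> ?m v"
        using ratio_test[where \<alpha> = ?m and \<gamma> = ?r, OF basis_finite[OF b] m] by blast
      have "v0 \<in> F" using v0 rep[OF FB[OF True] B(1), of v0] by (auto split: if_splits)
      have "x \<notin> B" using sub[OF B(1)] xW by auto
      then have "y \<in> posc (nw (B, v0))"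
        unfolding nw_def prod.case by (rule posc_exchange[OF b v0(1,3,4) _ nn])
      then show ?thesis using new[OF True \<open>v0 \<in> F\<close>] by blast
    qed
  qed
  have "\<forall>w\<in>insert x W. 0 < h' w" using hpos \<epsilon> by (auto simp: h'_def)
  then show ?thesis using count cover unfolding T_def T'_def by blast
qed

text \<open>The hypothesis on rays also compares points of \<open>X\<close> with each other, because
  each inserted point is a generator for the later insertions.\<close>

lemma cells_insert_many:
  fixes X :: "'a::euclidean_space set"
  assumes "finite X" "finite W" "span W = UNIV" "\<And>w. w \<in> W \<Longrightarrow> 0 < h w"
    and "\<And>x w t. x \<in> X \<Longrightarrow> w \<in> W \<union> X \<Longrightarrow> x \<noteq> w \<Longrightarrow> 0 \<le> t \<Longrightarrow> x \<noteq> t *\<^sub>R w"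
    and "X \<inter> W = {}" "X \<subseteq> interior K" "K \<subseteq> (\<Union>B\<in>cells W h. posc B)"
  shows "\<exists>h'. (\<forall>w\<in>W \<union> X. 0 < h' w) \<and> K \<subseteq> (\<Union>B\<in>cells (W \<union> X) h'. posc B) \<and>
    card (cells W h) + (DIM('a) - 1) * card X \<le> card (cells (W \<union> X) h')"
  using assms
proof (induction X rule: finite_induct)
  case empty
  then show ?case by auto
next
  case (insert x X)
  have "\<exists>h'. (\<forall>w\<in>W \<union> X. 0 < h' w) \<and> K \<subseteq> (\<Union>B\<in>cells (W \<union> X) h'. posc B) \<and>
    card (cells W h) + (DIM('a) - 1) * card X \<le> card (cells (W \<union> X) h')"
    by (rule insert.IH) (use insert.prems in auto)
  then obtain h1 where h1: "\<forall>w\<in>W \<union> X. 0 < h1 w" "K \<subseteq> (\<Union>B\<in>cells (W \<union> X) h1. posc B)"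
    "card (cells W h) + (DIM('a) - 1) * card X \<le> card (cells (W \<union> X) h1)" by blast
  have "\<exists>h'. (\<forall>w\<in>insert x (W \<union> X). 0 < h' w) \<and> K \<subseteq> (\<Union>B\<in>cells (insert x (W \<union> X)) h'. posc B) \<and>
    card (cells (W \<union> X) h1) + DIM('a) - 1 \<le> card (cells (insert x (W \<union> X)) h')"
  proof (rule cells_insert)
    show "finite (W \<union> X)" using insert.hyps insert.prems by auto
    show "span (W \<union> X) = UNIV" using insert.prems(2) span_mono[of W "W \<union> X"] by auto
    show "x \<noteq> t *\<^sub>R w" if "w \<in> W \<union> X" "0 \<le> t" for w t
    proof -
      have "x \<noteq> w" using that insert.hyps insert.prems(5) by auto
      then show ?thesis using that insert.prems(4)[of x w t] by auto
    qed
  qed (use h1 insert.prems in auto)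
  then obtain h' where h': "\<forall>w\<in>insert x (W \<union> X). 0 < h' w"
    "K \<subseteq> (\<Union>B\<in>cells (insert x (W \<union> X)) h'. posc B)"
    "card (cells (W \<union> X) h1) + DIM('a) - 1 \<le> card (cells (insert x (W \<union> X)) h')" by blast
  have "(DIM('a) - 1) * card (insert x X) = (DIM('a) - 1) * card X + (DIM('a) - 1)"
    unfolding card_insert_disjoint[OF insert.hyps] by (simp only: mult_Suc_right add.commute)
  moreover have "card (cells (W \<union> X) h1) + DIM('a) - 1 = card (cells (W \<union> X) h1) + (DIM('a) - 1)"
    using DIM_positive[where 'a='a] by linarith
  ultimately have "card (cells W h) + (DIM('a) - 1) * card (insert x X) \<le> card (cells (insert x (W \<union> X)) h')"
    using h1(3) h'(3) by linarith
  then show ?case using h'(1,2) by (intro exI[of _ h']) auto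
qed

section \<open>An initial complete fan\<close>

text \<open>Arithmetic of one extension. \<open>D\<close> is the dimension, \<open>r\<close> the
  excess of the number of generators over \<open>D\<close>, and \<open>N\<close> the number of
  cones. A circuit of \<open>k + 1\<close> vectors raises the dimension by \<open>k\<close> and the
  excess by 1, and multiplies the lower bound for the cones by \<open>k + 1\<close>.\<close>

lemma fan_count_step:
  fixes D r k N :: nat
  assumes "2 + (D - 1) * r \<le> N" "1 \<le> r" "r \<le> D" "1 \<le> k"
  shows "2 + (D + k - 1) * (r + 1) \<le> N * (k + 1)"
proof -
  obtain e where D: "D = Suc e" using assms by (cases D) auto
  have "e + k * r \<le> k + e * r * k"
  proof (cases e)
    case 0
    \<comment> \<open>Here \<open>D = 1\<close>, so \<open>r = 1\<close> and both sides equal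
      \<open>k\<close>.\<close>
    then show ?thesis using assms D by simp
  next
    case (Suc e')
    have "1 * 1 \<le> k * r" using assms by (intro mult_le_mono)
    then have "e' * 1 \<le> e' * (k * r)" by (intro mult_le_mono) auto
    moreover have "k + e * r * k = k + e' * (k * r) + k * r" using Suc by (simp add: algebra_simps)
    ultimately show ?thesis using assms(4) Suc by linarith
  qed
  then have "2 + (D + k - 1) * (r + 1) \<le> (2 + e * r) * (k + 1)" using D by (simp add: algebra_simps)
  also have "\<dots> \<le> N * (k + 1)" using assms D by (intro mult_right_mono) auto
  finally show ?thesis .
qed

text \<open>A fan in the subspace \<open>span W\<close> is enlarged by a circuit \<open>C\<close> of the quotient space: the new cells
  are the old ones joined with all proper maximal subsets of \<open>C\<close>, all points of \<open>C\<close> receiving one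
  large cost \<open>M\<close>.\<close>

lemma fan_extend:
  fixes V :: "'a::euclidean_space set"
  assumes V: "finite V" "span V = UNIV" "\<And>v. v \<in> V \<Longrightarrow> 0 < \<beta> v" "(\<Sum>v\<in>V. \<beta> v *\<^sub>R v) = 0"
    and W: "W \<subseteq> V" "span W \<noteq> UNIV" "\<And>w. w \<in> W \<Longrightarrow> 0 < h w"
      "span W \<subseteq> (\<Union>B\<in>cells W h. posc B)"
  shows "\<exists>C h'. C \<subseteq> V \<and> C \<inter> W = {} \<and> 2 \<le> card C \<and> (\<forall>w\<in>W \<union> C. 0 < h' w) \<and>
    span (W \<union> C) \<subseteq> (\<Union>B\<in>cells (W \<union> C) h'. posc B) \<and>
    card (cells W h) * card C \<le> card (cells (W \<union> C) h') \<and>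
    dim (W \<union> C) + 1 = dim W + card C"
proof -
  define S where "S = span W"
  have subS: "subspace S" by (simp add: S_def)
  \<comment> \<open>Sets with a strictly positive linear relation modulo \<open>S\<close>. The
    relation \<beta> makes \<open>V - S\<close> such a set, and one of least cardinality is a
    circuit of the quotient by \<open>S\<close>.\<close>
  define good where "good C \<longleftrightarrow> C \<subseteq> V - S \<and> C \<noteq> {} \<and>
    (\<exists>\<alpha>. (\<forall>c\<in>C. 0 < \<alpha> c) \<and> (\<Sum>c\<in>C. \<alpha> c *\<^sub>R c) \<in> S)" for C
  have "good (V - S)"
    unfolding good_def
  proof (intro conjI exI[of _ \<beta>])
    show "V - S \<noteq> {}"
      using V(2) W(2) span_minimal[of V S] subS by (auto simp: S_def)
    have "(\<Sum>v\<in>V. \<beta> v *\<^sub>R v) = (\<Sum>v\<in>V - S. \<beta> v *\<^sub>R v) + (\<Sum>v\<in>V \<inter> S. \<beta> v *\<^sub>R v)"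
      using sum.Int_Diff[OF V(1), of _ S] by (metis add.commute)
    then have "(\<Sum>v\<in>V - S. \<beta> v *\<^sub>R v) = - (\<Sum>v\<in>V \<inter> S. \<beta> v *\<^sub>R v)"
      using V(4) by (simp add: eq_neg_iff_add_eq_0)
    moreover have "(\<Sum>v\<in>V \<inter> S. \<beta> v *\<^sub>R v) \<in> S"
      by (intro subspace_sum subspace_scale subS) auto
    ultimately show "(\<Sum>v\<in>V - S. \<beta> v *\<^sub>R v) \<in> S" using subspace_neg[OF subS] by simp
  qed (use V(3) in auto)
  then obtain C where C: "good C" "\<And>C'. good C' \<Longrightarrow> card C \<le> card C'"
    using ex_has_least_nat[of good "V - S" card] by blast
  then obtain \<alpha> where \<alpha>: "\<And>c. c \<in> C \<Longrightarrow> 0 < \<alpha> c" "(\<Sum>c\<in>C. \<alpha> c *\<^sub>R c) \<in> S"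
    by (auto simp: good_def)
  have CV: "C \<subseteq> V" "C \<inter> S = {}" "C \<noteq> {}" using C by (auto simp: good_def)
  have finC: "finite C" using finite_subset[OF CV(1) V(1)] .
  have WS: "W \<subseteq> S" by (simp add: S_def span_superset)
  have finW: "finite W" using finite_subset[OF W(1) V(1)] .
  \<comment> \<open>Subtract the largest admissible multiple of \<gamma> from \<alpha>. The entry
    \<open>c0\<close> survives because \<gamma> vanishes there, while another entry becomes zero, so
    a smaller good set appears.\<close>
  have circuit: False
    if "(\<Sum>c\<in>C. \<gamma> c *\<^sub>R c) \<in> S" "c0 \<in> C" "\<gamma> c0 = 0" "c1 \<in> C" "0 < \<gamma> c1" for \<gamma> c0 c1
  proof -
    have "0 \<le> \<alpha> c" if "c \<in> C" for c using \<alpha>(1)[OF that] by simp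
    from ratio_test[where \<alpha> = \<alpha> and \<gamma> = \<gamma>, OF finC this that(4,5)]
    obtain m t where m: "m \<in> C" "\<alpha> m = t * \<gamma> m" and nn: "\<And>c. c \<in> C \<Longrightarrow> t * \<gamma> c \<le> \<alpha> c"
      by blast
    let ?C = "{c\<in>C. \<alpha> c - t * \<gamma> c \<noteq> 0}"
    have "good ?C"
      unfolding good_def
    proof (intro conjI exI[of _ "\<lambda>c. \<alpha> c - t * \<gamma> c"])
      show "?C \<subseteq> V - S" using CV by auto
      show "?C \<noteq> {}" using that(2,3) \<alpha>(1)[OF that(2)] by auto
      show "\<forall>c\<in>?C. 0 < \<alpha> c - t * \<gamma> c" using nn by force
      have "(\<Sum>c\<in>?C. (\<alpha> c - t * \<gamma> c) *\<^sub>R c) = (\<Sum>c\<in>C. (\<alpha> c - t * \<gamma> c) *\<^sub>R c)"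
        by (rule sum.mono_neutral_left) (use finC in auto)
      also have "\<dots> = (\<Sum>c\<in>C. \<alpha> c *\<^sub>R c) - t *\<^sub>R (\<Sum>c\<in>C. \<gamma> c *\<^sub>R c)"
        by (simp add: scaleR_left_diff_distrib sum_subtractf scaleR_sum_right)
      also have "\<dots> \<in> S" using \<alpha>(2) that(1) subS by (simp add: subspace_diff subspace_scale)
      finally show "(\<Sum>c\<in>?C. (\<alpha> c - t * \<gamma> c) *\<^sub>R c) \<in> S" .
    qed
    then have "card C \<le> card ?C" by (rule C(2))
    moreover have "m \<in> C" "m \<notin> ?C" using m by auto
    then have "?C \<subset> C" by blast
    ultimately show False using psubset_card_mono[OF finC, of ?C] by linarith
  qed
  \<comment> \<open>Hence removing any one point of \<open>C\<close> leaves a family that is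
    independent modulo \<open>S\<close>.\<close>
  have circuit0: "\<gamma> c1 = 0"
    if "(\<Sum>c\<in>C. \<gamma> c *\<^sub>R c) \<in> S" "c0 \<in> C" "\<gamma> c0 = 0" "c1 \<in> C" for \<gamma> c0 c1
  proof (rule ccontr)
    assume "\<gamma> c1 \<noteq> 0"
    then consider "0 < \<gamma> c1" | "0 < - \<gamma> c1" by linarith
    then show False
    proof cases
      case 1
      then show False using circuit that by blast
    next
      case 2
      have "(\<Sum>c\<in>C. (- \<gamma> c) *\<^sub>R c) \<in> S"
        using subspace_neg[OF subS that(1)] by (simp add: sum_negf)
      then show False using circuit[of "\<lambda>c. - \<gamma> c" c0 c1] that 2 by auto
    qed
  qed
  have card2: "2 \<le> card C"
  proof (rule ccontr)
    assume "\<not> 2 \<le> card C"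
    moreover have "card C \<noteq> 0" using CV finC by auto
    ultimately have "card C = 1" by linarith
    then obtain c where c: "C = {c}" by (auto simp: card_1_singleton_iff)
    then have "\<alpha> c *\<^sub>R c \<in> S" "0 < \<alpha> c" using \<alpha> by auto
    then have "c \<in> S" using subspace_scale[OF subS, of "\<alpha> c *\<^sub>R c" "1 / \<alpha> c"] by simp
    then show False using CV c by auto
  qed
  define T where "T = cells W h"
  have T: "B \<subseteq> W" "independent B" "span B = S" "finite B" "B \<inter> C = {}" if "B \<in> T" for B
    using that finW finite_subset CV WS by (auto simp: T_def cells_def S_def)
  have "\<forall>B\<in>T. \<exists>f. linear f \<and> (\<forall>v\<in>B. f v = h v) \<and> (\<forall>w\<in>W - B. f w < h w)"
    by (auto simp: T_def cells_def)
  then obtain f where f: "\<And>B. B \<in> T \<Longrightarrow> linear (f B)" "\<And>B v. B \<in> T \<Longrightarrow> v \<in> B \<Longrightarrow> f B v = h v"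
    "\<And>B w. B \<in> T \<Longrightarrow> w \<in> W - B \<Longrightarrow> f B w < h w"
    by metis
  have finT: "finite T" using finite_cells[OF finW] by (simp add: T_def)
  define y0 where "y0 = (\<Sum>c\<in>C. \<alpha> c *\<^sub>R c)"
  have y0: "y0 \<in> S" using \<alpha> by (simp add: y0_def)
  define A where "A = sum \<alpha> C"
  have A: "0 < A" unfolding A_def by (rule sum_pos) (use finC CV \<alpha> in auto)
  \<comment> \<open>For every cell \<open>B\<close>, paying \<open>M\<close> on all of
    \<open>C\<close> must make \<open>y0\<close> dearer than its cost \<open>f B y0\<close> inside
    \<open>S\<close>. The relation for \<open>y0\<close> then forces the value at the omitted point
    \<open>c\<close> below \<open>M\<close>. The summand 1 gives strictness and positivity.\<close>
  define M where "M = 1 + (\<Sum>B\<in>T. \<bar>f B y0\<bar>) / A"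
  have "0 \<le> (\<Sum>B\<in>T. \<bar>f B y0\<bar>) / A" using A by (intro divide_nonneg_pos sum_nonneg) auto
  then have M0: "0 < M" by (simp add: M_def)
  have M: "f B y0 < M * A" if "B \<in> T" for B
  proof -
    have "f B y0 \<le> \<bar>f B y0\<bar>" by simp
    also have "\<dots> \<le> (\<Sum>B\<in>T. \<bar>f B y0\<bar>)" using that finT by (intro member_le_sum) auto
    also have "\<dots> < M * A" using A by (simp add: M_def algebra_simps)
    finally show ?thesis .
  qed
  define h' where "h' w = (if w \<in> C then M else h w)" for w
  define nw where "nw = (\<lambda>(B, c::'a). B \<union> (C - {c}))"
  have fin_nw: "finite (nw (B, c))" if "B \<in> T" for B c using T[OF that] finC by (simp add: nw_def)
  have sum_nw: "(\<Sum>v\<in>nw (B, c). k v) = sum k B + (\<Sum>v\<in>C - {c}. k v)" if "B \<in> T"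
    for B c and k :: "'a \<Rightarrow> 'a"
    unfolding nw_def prod.case using T[OF that] finC by (intro sum.union_disjoint) auto
  have ind: "independent (nw (B, c))" if B: "B \<in> T" and c: "c \<in> C" for B c
  proof (rule independent_if_scalars_zero[OF fin_nw[OF B]])
    fix k v assume s: "(\<Sum>x\<in>nw (B, c). k x *\<^sub>R x) = 0" and v: "v \<in> nw (B, c)"
    let ?k = "\<lambda>u. if u = c then 0 else k u"
    have BS: "(\<Sum>u\<in>B. k u *\<^sub>R u) \<in> S"
      using T[OF B] WS by (intro subspace_sum subspace_scale subS) auto
    have "(\<Sum>u\<in>C. ?k u *\<^sub>R u) = (\<Sum>u\<in>C - {c}. k u *\<^sub>R u)"
      by (rule sum.mono_neutral_cong_right) (use finC in auto)
    also have "\<dots> = - (\<Sum>u\<in>B. k u *\<^sub>R u)"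
      using s sum_nw[OF B, of "\<lambda>u. k u *\<^sub>R u" c] by (simp add: eq_neg_iff_add_eq_0 add.commute)
    finally have "(\<Sum>u\<in>C. ?k u *\<^sub>R u) \<in> S" using BS subspace_neg[OF subS] by simp
    then have z: "?k u = 0" if "u \<in> C" for u using circuit0[of ?k c u] c that by simp
    have zC: "k u = 0" if "u \<in> C - {c}" for u using z[of u] that by (auto split: if_splits)
    then have "(\<Sum>u\<in>B. k u *\<^sub>R u) = 0" using s sum_nw[OF B, of "\<lambda>u. k u *\<^sub>R u" c] by simp
    then have "\<forall>u\<in>B. k u = 0" using T(2)[OF B] by (simp add: independent_explicit)
    then show "k v = 0" using zC v by (auto simp: nw_def)
  qed
  have spn: "span (nw (B, c)) = span (W \<union> C)" if B: "B \<in> T" and c: "c \<in> C" for B c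
  proof
    show "span (nw (B, c)) \<subseteq> span (W \<union> C)" using T(1)[OF B] by (intro span_mono) (auto simp: nw_def)
    have SD: "S \<subseteq> span (nw (B, c))" using T(3)[OF B] span_mono[of B "nw (B, c)"] by (auto simp: nw_def)
    have "y0 = \<alpha> c *\<^sub>R c + (\<Sum>u\<in>C - {c}. \<alpha> u *\<^sub>R u)"
      unfolding y0_def by (rule sum.remove[OF finC c])
    then have "\<alpha> c *\<^sub>R c = y0 - (\<Sum>u\<in>C - {c}. \<alpha> u *\<^sub>R u)" by simp
    also have "\<dots> \<in> span (nw (B, c))"
    proof (rule span_diff)
      show "y0 \<in> span (nw (B, c))" using y0 SD by blast
      show "(\<Sum>u\<in>C - {c}. \<alpha> u *\<^sub>R u) \<in> span (nw (B, c))"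
        by (intro span_sum span_scale span_base) (auto simp: nw_def)
    qed
    finally have "c \<in> span (nw (B, c))"
      using span_scale[of "\<alpha> c *\<^sub>R c" "nw (B, c)" "1 / \<alpha> c"] \<alpha>(1)[OF c] by simp
    moreover have "C - {c} \<subseteq> span (nw (B, c))"
      using span_superset[of "nw (B, c)"] by (auto simp: nw_def)
    ultimately have "W \<union> C \<subseteq> span (nw (B, c))" using SD WS by auto
    then show "span (W \<union> C) \<subseteq> span (nw (B, c))" by (simp add: span_minimal)
  qed
  have mem: "nw (B, c) \<in> cells (W \<union> C) h'" if B: "B \<in> T" and c: "c \<in> C" for B c
  proof -
    obtain F where F: "linear F" "\<And>u. u \<in> nw (B, c) \<Longrightarrow> F u = h' u"
      using linear_independent_extend[OF ind[OF B c], of h'] by blast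
    have FS: "F y = f B y" if "y \<in> S" for y
    proof (rule linear_eq_on[OF F(1) f(1)[OF B], of y B])
      show "y \<in> span B" using that T(3)[OF B] by simp
      show "F b = f B b" if "b \<in> B" for b
        using F(2)[of b] f(2)[OF B that] that T(5)[OF B] by (auto simp: nw_def h'_def)
    qed
    have FC: "F u = M" if "u \<in> C - {c}" for u using F(2)[of u] that by (auto simp: nw_def h'_def)
    have "F y0 = (\<Sum>u\<in>C. \<alpha> u * F u)" unfolding y0_def by (rule linear_combination[OF F(1)])
    also have "\<dots> = \<alpha> c * F c + (\<Sum>u\<in>C - {c}. \<alpha> u * F u)" by (rule sum.remove[OF finC c])
    also have "(\<Sum>u\<in>C - {c}. \<alpha> u * F u) = (\<Sum>u\<in>C - {c}. \<alpha> u) * M"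
      using FC by (simp add: sum_distrib_right)
    also have "(\<Sum>u\<in>C - {c}. \<alpha> u) = A - \<alpha> c" unfolding A_def using sum.remove[OF finC c, of \<alpha>] by simp
    finally have "\<alpha> c * F c + (A - \<alpha> c) * M = f B y0" using FS[OF y0] by simp
    then have "\<alpha> c * F c < \<alpha> c * M" using M[OF B] by (simp add: algebra_simps)
    then have Fc: "F c < M" using \<alpha>(1)[OF c] by simp
    have "F w < h' w" if "w \<in> (W \<union> C) - nw (B, c)" for w
    proof (cases "w \<in> C")
      case True
      then have "w = c" using that by (auto simp: nw_def)
      then show ?thesis using Fc c by (simp add: h'_def)
    next
      case False
      then have "w \<in> W - B" using that by (auto simp: nw_def)
      then show ?thesis using f(3)[OF B] FS[of w] WS False by (auto simp: h'_def)
    qed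
    then show ?thesis
      unfolding cells_def using F ind[OF B c] spn[OF B c] T(1)[OF B] by (auto simp: nw_def)
  qed
  have inj: "inj_on nw (T \<times> C)"
  proof (intro inj_onI, clarsimp)
    fix B c B' c' assume a: "B \<in> T" "c \<in> C" "B' \<in> T" "c' \<in> C" "nw (B, c) = nw (B', c')"
    then show "B = B' \<and> c = c'" using T(5)[OF a(1)] T(5)[OF a(3)] by (auto simp: nw_def)
  qed
  have cover: "span (W \<union> C) \<subseteq> (\<Union>B\<in>cells (W \<union> C) h'. posc B)"
  proof
    fix y assume "y \<in> span (W \<union> C)"
    then obtain s1 s2 where y: "y = s1 + s2" "s1 \<in> S" "s2 \<in> span C"
      unfolding span_Un S_def by auto
    then obtain b where b: "s2 = (\<Sum>c\<in>C. b c *\<^sub>R c)" using finC by (auto simp: span_finite)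
    \<comment> \<open>A multiple of \<open>y0\<close> may be moved between the two summands of
      \<open>y\<close>. The multiple \<open>t\<close>, possibly negative, is chosen so that the
      coefficients on \<open>C\<close> become non-negative and that of \<open>c\<close> vanishes;
      the part in \<open>S\<close> is covered in any case because the old fan is complete
      there.\<close>
    obtain c where c: "c \<in> C" "\<And>u. u \<in> C \<Longrightarrow> b c / \<alpha> c \<le> b u / \<alpha> u"
      by (rule finite_obtain_min[OF finC CV(3), of "\<lambda>u. b u / \<alpha> u"]) blast
    define t where "t = b c / \<alpha> c"
    have nn: "0 \<le> b u - t * \<alpha> u" if "u \<in> C" for u
      using c(2)[OF that] \<alpha>(1)[OF that] by (simp add: t_def pos_le_divide_eq)
    have z: "b c - t * \<alpha> c = 0" using \<alpha>(1)[OF c(1)] by (simp add: t_def)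
    have "s1 + t *\<^sub>R y0 \<in> S" using y y0 subS by (simp add: subspace_add subspace_scale)
    then obtain B where B: "B \<in> T" "s1 + t *\<^sub>R y0 \<in> posc B" using W(4) by (auto simp: S_def T_def)
    obtain \<mu> where \<mu>: "\<And>v. v \<in> B \<Longrightarrow> 0 \<le> \<mu> v" "s1 + t *\<^sub>R y0 = (\<Sum>v\<in>B. \<mu> v *\<^sub>R v)"
      by (rule poscE[OF B(2)]) blast
    have "s2 - t *\<^sub>R y0 = (\<Sum>u\<in>C. (b u - t * \<alpha> u) *\<^sub>R u)"
      by (simp add: b y0_def scaleR_left_diff_distrib sum_subtractf scaleR_sum_right)
    also have "\<dots> = (\<Sum>u\<in>C - {c}. (b u - t * \<alpha> u) *\<^sub>R u)"
      by (rule sum.mono_neutral_right) (use finC z in auto)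
    finally have y': "y = (\<Sum>v\<in>B. \<mu> v *\<^sub>R v) + (\<Sum>u\<in>C - {c}. (b u - t * \<alpha> u) *\<^sub>R u)"
      using \<mu>(2) y(1) by (simp add: algebra_simps)
    have "y \<in> posc (nw (B, c))"
    proof (rule poscI)
      let ?k = "\<lambda>v. if v \<in> B then \<mu> v else b v - t * \<alpha> v"
      show "0 \<le> ?k v" if "v \<in> nw (B, c)" for v using that \<mu>(1) nn by (auto simp: nw_def)
      have "(\<Sum>u\<in>C - {c}. (b u - t * \<alpha> u) *\<^sub>R u) = (\<Sum>u\<in>C - {c}. ?k u *\<^sub>R u)"
        by (rule sum.cong) (use T(5)[OF B(1)] in auto)
      then show "y = (\<Sum>v\<in>nw (B, c). ?k v *\<^sub>R v)" unfolding sum_nw[OF B(1)] y' by simp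
    qed
    then show "y \<in> (\<Union>B\<in>cells (W \<union> C) h'. posc B)" using mem[OF B(1) c(1)] by blast
  qed
  have "card T * card C = card (nw ` (T \<times> C))" using card_image[OF inj] by (simp add: card_cartesian_product)
  also have "\<dots> \<le> card (cells (W \<union> C) h')"
    by (rule card_mono) (use finite_cells[of "W \<union> C" h'] finW finC mem in auto)
  finally have count: "card (cells W h) * card C \<le> card (cells (W \<union> C) h')" by (simp add: T_def)
  obtain B where B: "B \<in> T" using W(4) span_zero[of W] by (auto simp: T_def)
  obtain c where c: "c \<in> C" using CV by auto
  have "dim (W \<union> C) = card (nw (B, c))"
    using spn[OF B c] ind[OF B c] by (metis dim_eq_card_independent dim_span)
  also have "\<dots> = card B + (card C - 1)"
    unfolding nw_def prod.case using T[OF B] finC c by (subst card_Un_disjoint) auto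
  also have "card B = dim W"
    using T(2,3)[OF B] by (metis S_def dim_eq_card_independent dim_span)
  finally have "dim (W \<union> C) + 1 = dim W + card C" using card2 by simp
  moreover have "\<forall>w\<in>W \<union> C. 0 < h' w" using W(3) M0 by (auto simp: h'_def)
  ultimately show ?thesis using CV(1,2) WS card2 count cover by (intro exI[of _ C] exI[of _ h']) auto
qed

text \<open>Circuits are added until the span is everything. \<open>r\<close> counts them: each adds
  one more vector than dimensions, and at least one dimension, whence
  \<open>r \<le> dim W\<close>.\<close>

lemma initial_fan_from:
  fixes V :: "'a::euclidean_space set"
  assumes V: "finite V" "span V = UNIV" "\<And>v. v \<in> V \<Longrightarrow> 0 < \<beta> v" "(\<Sum>v\<in>V. \<beta> v *\<^sub>R v) = 0"
    and W: "W \<subseteq> V" "\<And>w. w \<in> W \<Longrightarrow> 0 < h w" "span W \<subseteq> (\<Union>B\<in>cells W h. posc B)"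
    and N: "1 \<le> r" "r \<le> dim W" "card W = dim W + r" "2 + (dim W - 1) * r \<le> card (cells W h)"
  shows "\<exists>W h. W \<subseteq> V \<and> span W = UNIV \<and> (\<forall>w\<in>W. 0 < h w) \<and> UNIV \<subseteq> (\<Union>B\<in>cells W h. posc B) \<and>
    DIM('a) \<le> card W \<and> 2 + (DIM('a) - 1) * (card W - DIM('a)) \<le> card (cells W h)"
  using W N
proof (induction "DIM('a) - dim W" arbitrary: W h r rule: less_induct)
  case less
  show ?case
  proof (cases "span W = UNIV")
    case True
    then have "dim W = DIM('a)" by (metis dim_UNIV dim_span)
    then show ?thesis using less.prems True by (intro exI[of _ W] exI[of _ h]) auto
  next
    case False
    from fan_extend[OF V less.prems(1) False less.prems(2,3)]
    obtain C h' where C: "C \<subseteq> V" "C \<inter> W = {}" "2 \<le> card C" "\<forall>w\<in>W \<union> C. 0 < h' w"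
      "span (W \<union> C) \<subseteq> (\<Union>B\<in>cells (W \<union> C) h'. posc B)"
      "card (cells W h) * card C \<le> card (cells (W \<union> C) h')" "dim (W \<union> C) + 1 = dim W + card C"
      by blast
    have "finite W" "finite C" using finite_subset[OF _ V(1)] C(1) less.prems(1) by auto
    then have cU: "card (W \<union> C) = card W + card C" using C(2) by (intro card_Un_disjoint) auto
    define k where "k = card C - 1"
    have k: "card C = k + 1" "1 \<le> k" "dim (W \<union> C) = dim W + k" using C by (auto simp: k_def)
    have dle: "dim (W \<union> C) \<le> DIM('a)" by (rule dim_subset_UNIV)
    show ?thesis
    proof (rule less.hyps[of "W \<union> C" h' "r + 1"])
      show "2 + (dim (W \<union> C) - 1) * (r + 1) \<le> card (cells (W \<union> C) h')"
        using fan_count_step[OF less.prems(7,4,5) k(2)] C(6) k by simp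
      show "DIM('a) - dim (W \<union> C) < DIM('a) - dim W" using k dle by linarith
    qed (use C less.prems k cU in auto)
  qed
qed

text \<open>The start is the fan of the zero subspace, whose only cell is the empty set. The first
  circuit \<open>C\<close> has \<open>dim C + 1\<close> points and yields at least that many cones,
  which is the required count for \<open>r = 1\<close>; this is the origin of the constant
  2.\<close>

lemma initial_fan:
  fixes V :: "'a::euclidean_space set"
  assumes V: "finite V" "span V = UNIV" "\<And>v. v \<in> V \<Longrightarrow> 0 < \<beta> v" "(\<Sum>v\<in>V. \<beta> v *\<^sub>R v) = 0"
  shows "\<exists>W h. W \<subseteq> V \<and> span W = UNIV \<and> (\<forall>w\<in>W. 0 < h w) \<and> UNIV \<subseteq> (\<Union>B\<in>cells W h. posc B) \<and>
    DIM('a) \<le> card W \<and> 2 + (DIM('a) - 1) * (card W - DIM('a)) \<le> card (cells W h)"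
proof -
  let ?h = "\<lambda>_::'a. 1::real"
  have c0: "cells {} ?h = {{}::'a set}"
    by (auto simp: cells_def independent_empty intro!: exI[of _ "\<lambda>_. 0"] linear_zero)
  have "span ({}::'a set) \<noteq> UNIV" by (metis UNIV_not_singleton span_empty)
  moreover have "span {} \<subseteq> (\<Union>B\<in>cells {} ?h. posc (B::'a set))"
    by (simp add: c0 posc_def)
  ultimately obtain C h' where C: "C \<subseteq> V" "2 \<le> card C" "\<forall>w\<in>C. 0 < h' w"
      "span C \<subseteq> (\<Union>B\<in>cells C h'. posc B)" "card C \<le> card (cells C h')" "dim C + 1 = card C"
    using fan_extend[OF V, of "{}" ?h] by (auto simp: c0)
  show ?thesis
    by (rule initial_fan_from[OF V C(1), of h' 1]) (use C in auto)
qed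

section \<open>Regular triangulations by the simplex method\<close>

lemma eventually_at_right_0_neq:
  fixes a c :: real
  assumes "a \<noteq> 0 \<or> c \<noteq> 0"
  shows "\<forall>\<^sub>F \<epsilon> in at_right 0. a + \<epsilon> * c \<noteq> 0"
proof (cases "a = 0")
  case True
  then have "c \<noteq> 0" using assms by simp
  show ?thesis using eventually_at_right_less[of "0::real"]
    by eventually_elim (use True \<open>c \<noteq> 0\<close> in auto)
next
  case False
  have "((\<lambda>\<epsilon>. a + \<epsilon> * c) \<longlongrightarrow> a + 0 * c) (at_right 0)" by (intro tendsto_intros)
  then show ?thesis using False by (intro tendsto_imp_eventually_ne[of _ a]) auto
qed

text \<open>\<open>P\<close> lists strict inequalities to be kept, \<open>Q\<close> non-zero linear
  forms whose zero sets are to be avoided. Each form is treated by moving \<open>h\<close> in one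
  coordinate on which it depends, so little that nothing achieved earlier is lost.\<close>

lemma generic_perturbation:
  fixes h :: "'b \<Rightarrow> real"
  assumes W: "finite W" and P: "finite P" "\<And>p. p \<in> P \<Longrightarrow> 0 < (\<Sum>w\<in>W. p w * h w)"
    and Q: "finite Q" "\<And>q. q \<in> Q \<Longrightarrow> \<exists>w\<in>W. q w \<noteq> (0::real)"
  shows "\<exists>h'. (\<forall>p\<in>P. 0 < (\<Sum>w\<in>W. p w * h' w)) \<and> (\<forall>q\<in>Q. (\<Sum>w\<in>W. q w * h' w) \<noteq> 0)"
  using Q
proof (induction Q rule: finite_induct)
  case empty
  then show ?case using P by auto
next
  case (insert q Q)
  then obtain h1 where h1: "\<And>p. p \<in> P \<Longrightarrow> 0 < (\<Sum>w\<in>W. p w * h1 w)"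
    "\<And>q. q \<in> Q \<Longrightarrow> (\<Sum>w\<in>W. q w * h1 w) \<noteq> 0" by auto
  obtain w where w: "w \<in> W" "q w \<noteq> 0" using insert.prems by auto
  have e: "(\<Sum>u\<in>W. k u * (h1(w := h1 w + \<epsilon>)) u) = (\<Sum>u\<in>W. k u * h1 u) + \<epsilon> * k w" for k \<epsilon>
    using W w(1) by (simp add: sum.remove[of W w] algebra_simps)
  have "\<forall>\<^sub>F \<epsilon> in at_right 0. (\<forall>p\<in>P. 0 < (\<Sum>u\<in>W. p u * h1 u) + \<epsilon> * p w) \<and>
    (\<forall>q\<in>insert q Q. (\<Sum>u\<in>W. q u * h1 u) + \<epsilon> * q w \<noteq> 0)" (is "eventually ?E _")
  proof (intro eventually_conj eventually_ball_finite ballI)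
    fix p assume "p \<in> P"
    then have "\<forall>\<^sub>F \<epsilon> in at_right 0. - (\<Sum>u\<in>W. p u * h1 u) + \<epsilon> * - p w < 0"
      using h1(1) by (intro eventually_at_right_0_less) auto
    then show "\<forall>\<^sub>F \<epsilon> in at_right 0. 0 < (\<Sum>u\<in>W. p u * h1 u) + \<epsilon> * p w"
    proof eventually_elim
      case (elim \<epsilon>)
      moreover have "\<epsilon> * - p w = - (\<epsilon> * p w)" by simp
      ultimately show ?case by linarith
    qed
  next
    fix q' assume "q' \<in> insert q Q"
    then show "\<forall>\<^sub>F \<epsilon> in at_right 0. (\<Sum>u\<in>W. q' u * h1 u) + \<epsilon> * q' w \<noteq> 0"
      using w h1(2) by (intro eventually_at_right_0_neq) auto
  qed (use P insert.hyps in auto)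
  then obtain \<epsilon> where "?E \<epsilon>" using eventually_happens'[OF trivial_limit_at_right_real] by blast
  then show ?case using e by (intro exI[of _ "h1(w := h1 w + \<epsilon>)"]) auto
qed

text \<open>In linear programming terms this is the cost of \<open>y\<close> in the basis
  \<open>B\<close>, and \<open>h w - interp B h w\<close> is the reduced cost of
  \<open>w\<close>.\<close>

definition interp :: "'a::euclidean_space set \<Rightarrow> ('a \<Rightarrow> real) \<Rightarrow> 'a \<Rightarrow> real" where
  "interp B h y = (\<Sum>v\<in>B. representation B y v * h v)"

lemma interp_linear: "is_basis B \<Longrightarrow> linear (interp B h)"
  unfolding interp_def
  by (intro linearI) (simp_all add: linear_add[OF coord_linear] linear_cmul[OF coord_linear]
      algebra_simps sum.distrib sum_distrib_left)

lemma interp_basis: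
  assumes B: "is_basis B" and v: "v \<in> B"
  shows "interp B h v = h v"
proof -
  have "interp B h v = (\<Sum>u\<in>B. if u = v then h u else 0)"
    unfolding interp_def by (intro sum.cong) (auto simp: coord_basis[OF B v])
  then show ?thesis using basis_finite[OF B] v by simp
qed

text \<open>The functional in the definition of a cell is determined by its values on the basis.
  Being a cell thus becomes finitely many strict linear inequalities in \<open>h\<close>, which a
  small perturbation preserves.\<close>

lemma cells_iff_interp:
  assumes "span W = UNIV"
  shows "B \<in> cells W h \<longleftrightarrow> B \<subseteq> W \<and> is_basis B \<and> (\<forall>w\<in>W - B. interp B h w < h w)"
proof
  assume B: "B \<in> cells W h"
  then have b: "is_basis B" using cells_basis assms by blast
  obtain f where f: "linear f" "\<And>v. v \<in> B \<Longrightarrow> f v = h v" "\<And>w. w \<in> W - B \<Longrightarrow> f w < h w"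
    by (rule cellsE[OF B]) blast
  have "interp B h y = f y" for y
    using linear_coord_sum[OF b f(1)] f(2) by (simp add: interp_def)
  then show "B \<subseteq> W \<and> is_basis B \<and> (\<forall>w\<in>W - B. interp B h w < h w)"
    using f(3) b cells_subset[OF B] by simp
next
  assume "B \<subseteq> W \<and> is_basis B \<and> (\<forall>w\<in>W - B. interp B h w < h w)"
  then show "B \<in> cells W h" using interp_linear interp_basis by (intro cellsI[of B W "interp B h"]) auto
qed

text \<open>Caratheodory's theorem for cones: in a generating subset of least cardinality, a linear
  dependence could be subtracted until some coefficient vanishes.\<close>

lemma posc_independent_subset:
  assumes W: "finite W" and y: "y \<in> posc W"
  shows "\<exists>C\<subseteq>W. independent C \<and> y \<in> posc C"
proof -
  obtain C where C: "C \<subseteq> W \<and> y \<in> posc C" "\<And>C'. C' \<subseteq> W \<and> y \<in> posc C' \<Longrightarrow> card C \<le> card C'"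
    using ex_has_least_nat[of "\<lambda>C. C \<subseteq> W \<and> y \<in> posc C" W card] y by blast
  have finC: "finite C" using C(1) W finite_subset by blast
  obtain \<mu> where \<mu>: "\<And>v. v \<in> C \<Longrightarrow> 0 \<le> \<mu> v" "y = (\<Sum>v\<in>C. \<mu> v *\<^sub>R v)"
    using C(1) by (auto elim: poscE)
  have no: False if "(\<Sum>c\<in>C. \<gamma> c *\<^sub>R c) = 0" "c1 \<in> C" "0 < \<gamma> c1" for \<gamma> c1
  proof -
    from ratio_test[where \<alpha> = \<mu> and \<gamma> = \<gamma>, OF finC \<mu>(1) that(2,3)]
    obtain m t where m: "m \<in> C" "\<mu> m = t * \<gamma> m" and nn: "\<And>c. c \<in> C \<Longrightarrow> t * \<gamma> c \<le> \<mu> c"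
      by blast
    have "y = (\<Sum>c\<in>C. (\<mu> c - t * \<gamma> c) *\<^sub>R c)"
      using \<mu>(2) that(1) by (simp add: scaleR_left_diff_distrib sum_subtractf scaleR_sum_right[symmetric] flip: scaleR_scaleR)
    also have "\<dots> = (\<Sum>c\<in>C - {m}. (\<mu> c - t * \<gamma> c) *\<^sub>R c)"
      by (rule sum.mono_neutral_right) (use finC m in auto)
    finally have "y \<in> posc (C - {m})" by (rule poscI[rotated]) (use nn in auto)
    then have "card C \<le> card (C - {m})" using C by blast
    moreover have "card (C - {m}) < card C" using m(1) finC by (intro card_Diff1_less) auto
    ultimately show False by simp
  qed
  have "independent C"
  proof (rule independent_if_scalars_zero[OF finC])
    fix \<gamma> c assume s: "(\<Sum>c\<in>C. \<gamma> c *\<^sub>R c) = 0" "c \<in> C"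
    show "\<gamma> c = 0"
    proof (rule ccontr)
      assume "\<gamma> c \<noteq> 0"
      then consider "0 < \<gamma> c" | "0 < - \<gamma> c" by linarith
      then show False
      proof cases
        case 1
        then show False using no s by blast
      next
        case 2
        have "(\<Sum>c\<in>C. (- \<gamma> c) *\<^sub>R c) = 0" using s(1) by (simp add: sum_negf)
        then show False using no[of "\<lambda>c. - \<gamma> c" c] s 2 by auto
      qed
    qed
  qed
  then show ?thesis using C(1) by blast
qed

text \<open>The simplex method: among the bases whose cone contains \<open>y\<close>, one of minimal cost is a cell,
  because a point of \<open>W\<close> violating its optimality could be pivoted in. Positivity of \<open>h\<close> excludes
  unbounded pivot directions.\<close>

lemma generic_point_in_cell:
  fixes W :: "'a::euclidean_space set"
  assumes W: "finite W" "span W = UNIV" "\<And>w. w \<in> W \<Longrightarrow> 0 < h w"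
    and gen: "\<And>B w. \<lbrakk>B \<subseteq> W; is_basis B; w \<in> W - B\<rbrakk> \<Longrightarrow> interp B h w \<noteq> h w"
    and y: "y \<in> posc W" "\<And>D. \<lbrakk>D \<subseteq> W; span D \<noteq> UNIV\<rbrakk> \<Longrightarrow> y \<notin> span D"
  shows "\<exists>B\<in>cells W h. y \<in> posc B"
proof -
  define A where "A = {B. B \<subseteq> W \<and> is_basis B \<and> y \<in> posc B}"
  obtain C where C: "C \<subseteq> W" "independent C" "y \<in> posc C"
    using posc_independent_subset[OF W(1) y(1)] by blast
  have "y \<in> span C" by (rule poscE[OF C(3)]) (simp add: span_sum span_scale span_base)
  then have "span C = UNIV" using y(2) C(1) by blast
  then have "A \<noteq> {}" using C by (auto simp: A_def is_basis_def)
  moreover have "finite A" by (rule finite_subset[of _ "Pow W"]) (use W in \<open>auto simp: A_def\<close>)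
  ultimately obtain B where B: "B \<in> A" "\<And>B'. B' \<in> A \<Longrightarrow> interp B h y \<le> interp B' h y"
    using finite_obtain_min[of A "\<lambda>B. interp B h y"] by blast
  have BW: "B \<subseteq> W" and b: "is_basis B" and yB: "y \<in> posc B" using B(1) by (auto simp: A_def)
  let ?m = "representation B y"
  \<comment> \<open>Since \<open>y\<close> avoids all proper spans, no coordinate vanishes. This
    non-degeneracy makes the pivot length \<open>t\<close> positive, so the cost really
    drops.\<close>
  have mpos: "0 < ?m v" if v: "v \<in> B" for v
  proof -
    have "?m v \<noteq> 0"
    proof
      assume z: "?m v = 0"
      have "y = (\<Sum>u\<in>B. ?m u *\<^sub>R u)" using coord_sum[OF b] by simp
      also have "\<dots> = (\<Sum>u\<in>B - {v}. ?m u *\<^sub>R u)"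
        by (rule sum.mono_neutral_right) (use basis_finite[OF b] z in auto)
      also have "\<dots> \<in> span (B - {v})" by (intro span_sum span_scale span_base)
      finally have "y \<in> span (B - {v})" .
      moreover have "v \<notin> span (B - {v})" using b v by (auto simp: is_basis_def dependent_def)
      then have "span (B - {v}) \<noteq> UNIV" by auto
      ultimately show False using y(2)[of "B - {v}"] BW by auto
    qed
    then show ?thesis using yB v posc_basis_iff[OF b] by force
  qed
  have "interp B h w < h w" if w: "w \<in> W - B" for w
  proof (rule ccontr)
    assume "\<not> interp B h w < h w"
    then have gt: "h w < interp B h w" using gen[OF BW b w] by simp
    let ?c = "representation B w"
    have "\<exists>v\<in>B. 0 < ?c v"
    proof (rule ccontr)
      assume "\<not> ?thesis"
      then have "interp B h w \<le> 0"
        unfolding interp_def using BW W(3) by (intro sum_nonpos mult_nonpos_nonneg) (auto simp: less_imp_le not_less)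
      then show False using gt W(3)[of w] w by auto
    qed
    then obtain v1 where v1: "v1 \<in> B" "0 < ?c v1" by blast
    from ratio_test[where \<alpha> = ?m and \<gamma> = ?c, OF basis_finite[OF b] less_imp_le[OF mpos] v1]
    obtain v0 t where v0B: "v0 \<in> B" and c0: "0 < ?c v0" and z: "?m v0 = t * ?c v0" and t0: "0 \<le> t"
      and nn: "\<And>v. v \<in> B \<Longrightarrow> t * ?c v \<le> ?m v"
      by blast
    have t: "0 < t" using t0 z mpos[OF v0B] by (cases "t = 0") auto
    let ?B = "insert w (B - {v0})"
    have b': "is_basis ?B" using basis_exchange[OF b v0B] c0 by simp
    have "y \<in> posc ?B" by (rule posc_exchange[OF b v0B z _ _ nn]) (use t w in auto)
    then have "?B \<in> A" using b' BW w by (auto simp: A_def)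
    then have le: "interp B h y \<le> interp ?B h y" by (rule B(2))
    note l = interp_linear[OF b', of h]
    \<comment> \<open>The cost of \<open>y\<close> falls by \<open>t\<close> times the amount by
      which \<open>w\<close> violates optimality, against the minimality of
      \<open>B\<close>.\<close>
    have "interp ?B h y = interp ?B h (t *\<^sub>R w + (\<Sum>v\<in>B - {v0}. (?m v - t * ?c v) *\<^sub>R v))"
      using exchange_combination[OF b v0B z] by simp
    also have "\<dots> = t * interp ?B h w + (\<Sum>v\<in>B - {v0}. (?m v - t * ?c v) * interp ?B h v)"
      by (simp only: linear_add[OF l] linear_cmul[OF l] linear_combination[OF l] real_scaleR_def)
    also have "interp ?B h w = h w" by (rule interp_basis[OF b']) simp
    also have "(\<Sum>v\<in>B - {v0}. (?m v - t * ?c v) * interp ?B h v) = (\<Sum>v\<in>B - {v0}. (?m v - t * ?c v) * h v)"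
      by (intro sum.cong) (simp_all add: interp_basis[OF b'])
    also have "\<dots> = (\<Sum>v\<in>B. (?m v - t * ?c v) * h v)"
      by (rule sum.mono_neutral_left) (use basis_finite[OF b] z in auto)
    also have "\<dots> = interp B h y - t * interp B h w"
      by (simp add: interp_def algebra_simps sum_subtractf sum_distrib_left)
    finally have "interp ?B h y = interp B h y - t * (interp B h w - h w)" by (simp add: algebra_simps)
    moreover have "0 < t * (interp B h w - h w)" using t gt by simp
    ultimately show False using le by linarith
  qed
  then have "B \<in> cells W h" using cells_iff_interp[OF W(2)] BW b by blast
  then show ?thesis using yB by blast
qed

section \<open>Topology of cones and refinement of a partial fan\<close>

lemma closed_posc_basis:
  assumes "is_basis B" shows "closed (posc B)"
proof -
  have "posc B = (\<Inter>v\<in>B. {y. 0 \<le> representation B y v})" using posc_basis_iff[OF assms] by auto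
  moreover have "continuous_on UNIV (\<lambda>y. representation B y v)" for v
    using coord_linear[OF assms] by (simp add: linear_continuous_on linear_conv_bounded_linear)
  ultimately show ?thesis by (auto intro!: closed_Collect_le continuous_on_const)
qed

lemma posc_mono:
  assumes "finite W" "B \<subseteq> W" shows "posc B \<subseteq> posc W"
proof
  fix y assume "y \<in> posc B"
  then obtain \<mu> where \<mu>: "\<And>v. v \<in> B \<Longrightarrow> 0 \<le> \<mu> v" "y = (\<Sum>v\<in>B. \<mu> v *\<^sub>R v)" by (rule poscE) blast
  have "y = (\<Sum>v\<in>W. (if v \<in> B then \<mu> v else 0) *\<^sub>R v)"
    unfolding \<mu>(2) by (rule sum.mono_neutral_cong_left) (use assms in auto)
  then show "y \<in> posc W" using \<mu>(1) by (intro poscI[of W "\<lambda>v. if v \<in> B then \<mu> v else 0"]) auto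
qed

lemma interior_posc_basis:
  assumes "is_basis B" shows "interior (posc B) \<noteq> {}"
proof -
  let ?U = "\<Inter>v\<in>B. {y. 0 < representation B y v}"
  have "continuous_on UNIV (\<lambda>y. representation B y v)" for v
    using coord_linear[OF assms] by (simp add: linear_continuous_on linear_conv_bounded_linear)
  then have "open ?U" using basis_finite[OF assms]
    by (auto intro!: open_Collect_less continuous_on_const)
  moreover have "?U \<subseteq> posc B" using posc_basis_iff[OF assms] by (auto intro: less_imp_le)
  moreover have "(\<Sum>v\<in>B. v) \<in> ?U"
    using coord_eqI[OF assms, of "\<Sum>v\<in>B. v" "\<lambda>_. 1"] by auto
  ultimately show ?thesis using interior_maximal by blast
qed

lemma convex_posc: "convex (posc W)"
proof (rule convexI)
  fix x y and u v :: real assume a: "x \<in> posc W" "y \<in> posc W" "0 \<le> u" "0 \<le> v"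
  obtain \<mu> where \<mu>: "\<And>v. v \<in> W \<Longrightarrow> 0 \<le> \<mu> v" "x = (\<Sum>v\<in>W. \<mu> v *\<^sub>R v)" using a(1) by (rule poscE) blast
  obtain \<nu> where \<nu>: "\<And>v. v \<in> W \<Longrightarrow> 0 \<le> \<nu> v" "y = (\<Sum>v\<in>W. \<nu> v *\<^sub>R v)" using a(2) by (rule poscE) blast
  show "u *\<^sub>R x + v *\<^sub>R y \<in> posc W"
    by (rule poscI[of W "\<lambda>w. u * \<mu> w + v * \<nu> w"])
      (use \<mu> \<nu> a in \<open>auto simp: scaleR_sum_right scaleR_left_distrib sum.distrib\<close>)
qed

text \<open>Old cells survive a small perturbation of \<open>h\<close>. Once no reduced cost of a
  point outside a basis vanishes, the simplex method puts every generic point of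
  \<open>posc W\<close> into a cell, and the remaining points follow because finitely many closed
  cones have a closed union.\<close>

lemma cells_refine:
  fixes W :: "'a::euclidean_space set"
  assumes W: "finite W" "span W = UNIV" "\<And>w. w \<in> W \<Longrightarrow> 0 < h w"
  shows "\<exists>h'. (\<forall>w\<in>W. 0 < h' w) \<and> cells W h \<subseteq> cells W h' \<and> posc W \<subseteq> (\<Union>B\<in>cells W h'. posc B)"
proof -
  define bases where "bases = {B. B \<subseteq> W \<and> is_basis B}"
  have fin: "finite bases" "finite (cells W h)"
    using W finite_cells by (auto simp: bases_def)
  \<comment> \<open>The coefficients of the reduced cost of \<open>w\<close> in the basis
    \<open>B\<close>, as a linear form in the cost function.\<close>
  define q :: "'a set \<Rightarrow> 'a \<Rightarrow> 'a \<Rightarrow> real" where "q B w u = (if u = w then 1 else 0) - (if u \<in> B then representation B w u else 0)" for B w u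
  have q: "(\<Sum>u\<in>W. q B w u * k u) = k w - interp B k w" if "B \<subseteq> W" "w \<in> W" for B w k
  proof -
    have "(\<Sum>u\<in>W. q B w u * k u) = (\<Sum>u\<in>W. if u = w then k u else 0) - (\<Sum>u\<in>W. if u \<in> B then representation B w u * k u else 0)"
      unfolding q_def sum_subtractf[symmetric] by (intro sum.cong) (auto simp: algebra_simps)
    also have "(\<Sum>u\<in>W. if u \<in> B then representation B w u * k u else 0) = interp B k w"
      unfolding interp_def using that W(1) by (simp add: sum.If_cases Int_absorb1)
    finally show ?thesis using that W(1) by simp
  qed
  \<comment> \<open>To be kept: the inequalities of the old cells and the positivity of the costs.
    To be avoided, by \<open>?Q\<close> below: vanishing reduced costs for any basis in
    \<open>W\<close>.\<close>
  let ?P = "(\<Union>B\<in>cells W h. q B ` (W - B)) \<union> (\<lambda>w u. if u = w then 1 else 0) ` W"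
  let ?Q = "\<Union>B\<in>bases. q B ` (W - B)"
  have "\<exists>h'. (\<forall>p\<in>?P. 0 < (\<Sum>w\<in>W. p w * h' w)) \<and> (\<forall>q\<in>?Q. (\<Sum>w\<in>W. q w * h' w) \<noteq> 0)"
  proof (rule generic_perturbation[OF W(1), of _ h])
    show "finite ?P" "finite ?Q" using fin W(1) by auto
    show "0 < (\<Sum>w\<in>W. p w * h w)" if "p \<in> ?P" for p
      using that
    proof
      assume "p \<in> (\<Union>B\<in>cells W h. q B ` (W - B))"
      then obtain B w where "B \<in> cells W h" "w \<in> W - B" "p = q B w" by blast
      then show ?thesis using q[of B w h] by (auto simp: cells_iff_interp[OF W(2)])
    next
      assume "p \<in> (\<lambda>w u. if u = w then 1 else 0) ` W"
      then obtain w where "w \<in> W" "p = (\<lambda>u. if u = w then 1 else 0)" by blast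
      then show ?thesis using W by (simp add: if_distribR if_distrib[of "\<lambda>x. x * _"] cong: if_cong)
    qed
    show "\<exists>w\<in>W. r w \<noteq> 0" if "r \<in> ?Q" for r
    proof -
      from that obtain B w where "w \<in> W - B" "r = q B w" by blast
      then show ?thesis by (intro bexI[of _ w]) (auto simp: q_def)
    qed
  qed
  then obtain h' where "(\<forall>p\<in>?P. 0 < (\<Sum>w\<in>W. p w * h' w)) \<and> (\<forall>q\<in>?Q. (\<Sum>w\<in>W. q w * h' w) \<noteq> 0)" ..
  note h' = bspec[OF conjunct1[OF this]] bspec[OF conjunct2[OF this]]
  have pos: "0 < h' w" if "w \<in> W" for w
    using h'(1)[of "\<lambda>u. if u = w then 1 else 0"] that W(1)
    by (simp add: if_distribR if_distrib[of "\<lambda>x. x * _"] cong: if_cong)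
  have gen: "interp B h' w \<noteq> h' w" if "B \<subseteq> W" "is_basis B" "w \<in> W - B" for B w
  proof -
    have "q B w \<in> ?Q" unfolding bases_def using that by blast
    then show ?thesis using h'(2)[of "q B w"] that q[of B w h'] by auto
  qed
  have sub: "cells W h \<subseteq> cells W h'"
  proof
    fix B assume B: "B \<in> cells W h"
    have "interp B h' w < h' w" if "w \<in> W - B" for w
    proof -
      have "q B w \<in> ?P" using that B by blast
      then show ?thesis using h'(1)[of "q B w"] that cells_subset[OF B] q[of B w h'] by auto
    qed
    then show "B \<in> cells W h'" using B by (auto simp: cells_iff_interp[OF W(2)])
  qed
  let ?U = "\<Union>B\<in>cells W h'. posc B"
  \<comment> \<open>The non-generic points lie in finitely many proper subspaces, a null set that
    cannot contain a non-empty open uncovered region.\<close>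
  let ?N = "\<Union>D\<in>{D. D \<subseteq> W \<and> span D \<noteq> UNIV}. span D"
  have "closed ?U"
    using closed_posc_basis[OF cells_basis[OF _ W(2)]] by (intro closed_UN finite_cells W ballI)
  have "negligible ?N"
  proof (rule negligible_Union)
    show "finite (span ` {D. D \<subseteq> W \<and> span D \<noteq> UNIV})" using W(1) by simp
    show "negligible S" if "S \<in> span ` {D. D \<subseteq> W \<and> span D \<noteq> UNIV}" for S
    proof -
      from that obtain D where D: "S = span D" "span D \<noteq> UNIV" by blast
      then have "dim S < DIM('a)" using dim_eq_full[of D] dim_subset_UNIV[of D] by simp
      then show ?thesis by (rule negligible_lowdim)
    qed
  qed
  have "interior (posc W) \<subseteq> ?U"
  proof (rule ccontr)
    assume "\<not> ?thesis"
    then have "interior (posc W) - ?U \<noteq> {}" by blast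
    moreover have "open (interior (posc W) - ?U)" using \<open>closed ?U\<close> by (intro open_Diff) auto
    ultimately have "\<not> negligible (interior (posc W) - ?U)" by (simp add: open_not_negligible)
    moreover have "interior (posc W) - ?U \<subseteq> ?N"
    proof
      fix y assume y: "y \<in> interior (posc W) - ?U"
      show "y \<in> ?N"
      proof (rule ccontr)
        assume "y \<notin> ?N"
        then have "\<exists>B\<in>cells W h'. y \<in> posc B"
          using y interior_subset[of "posc W"]
          by (intro generic_point_in_cell[OF W(1,2) pos gen]) auto
        then show False using y by blast
      qed
    qed
    ultimately show False using \<open>negligible ?N\<close> by (meson negligible_subset)
  qed
  then have "closure (interior (posc W)) \<subseteq> ?U" using \<open>closed ?U\<close> by (simp add: closure_minimal)
  moreover have "interior (posc W) \<noteq> {}"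
  proof -
    obtain B where B: "B \<subseteq> W" "independent B" "W \<subseteq> span B" using maximal_independent_subset by blast
    then have "is_basis B" using W(2) span_minimal[OF B(3) subspace_span] by (auto simp: is_basis_def)
    then show ?thesis using interior_posc_basis interior_mono[OF posc_mono[OF W(1) B(1)]] by blast
  qed
  ultimately have "posc W \<subseteq> ?U" using convex_closure_interior[OF convex_posc] closure_subset by blast
  then show ?thesis using pos sub by blast
qed

section \<open>Volumes of lattice simplices\<close>

text \<open>The library computes the volume of a simplex in \<open>real ^ 'n\<close> only for well-ordered index types;
  this copy of a finite type carries such an order.\<close>

typedef 'a ordered_copy = "UNIV :: 'a set"
  morphisms of_copy to_copy by simp

lemma of_to_copy: "of_copy (to_copy i) = i"
  by (simp add: to_copy_inverse)

lemma bij_of_copy: "bij of_copy"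
  by (rule o_bij[of to_copy]) (auto simp: of_to_copy of_copy_inverse)

instantiation ordered_copy :: (finite) "{finite, wellorder}"
begin

definition less_eq_ordered_copy :: "'a ordered_copy \<Rightarrow> 'a ordered_copy \<Rightarrow> bool" where
  "less_eq_ordered_copy x y \<longleftrightarrow> to_nat (of_copy x) \<le> to_nat (of_copy y)"

definition less_ordered_copy :: "'a ordered_copy \<Rightarrow> 'a ordered_copy \<Rightarrow> bool" where
  "less_ordered_copy x y \<longleftrightarrow> to_nat (of_copy x) < to_nat (of_copy y)"

instance
proof
  show "finite (UNIV :: 'a ordered_copy set)"
    using bij_betw_finite[OF bij_of_copy[where 'a='a]] by simp
next
  fix P :: "'a ordered_copy \<Rightarrow> bool" and a
  assume *: "\<And>x. (\<And>y. y < x \<Longrightarrow> P y) \<Longrightarrow> P x"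
  show "P a"
  proof (induction a rule: measure_induct_rule[of "\<lambda>x. to_nat (of_copy x)"])
    case (less x)
    show ?case by (rule *) (rule less, simp add: less_ordered_copy_def)
  qed
qed (auto simp: less_eq_ordered_copy_def less_ordered_copy_def of_copy_inject)

end

section \<open>Relabelling coordinates and the determinant formula\<close>

definition recoord :: "real ^ 'n \<Rightarrow> real ^ 'n ordered_copy" where
  "recoord x = (\<chi> i. x $ of_copy i)"

lemma card_ordered_copy: "CARD('n ordered_copy) = CARD('n::finite)"
  using bij_betw_same_card[OF bij_of_copy[where 'a='n]] by simp

lemma linear_recoord: "linear recoord"
  by (intro linearI) (simp_all add: recoord_def vec_eq_iff)

lemma inj_recoord: "inj recoord"
proof (rule injI)
  fix x y :: "real ^ 'n" assume e: "recoord x = recoord y"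
  show "x = y"
  proof (rule vec_eq_iff[THEN iffD2], rule allI)
    fix i :: 'n
    have "recoord x $ to_copy i = recoord y $ to_copy i" using e by simp
    then show "x $ i = y $ i" by (simp add: recoord_def of_to_copy)
  qed
qed

lemma emeasure_box_cart:
  fixes l u :: "real ^ 'n"
  assumes "\<And>i. l $ i \<le> u $ i"
  shows "emeasure lborel (box l u) = ennreal (\<Prod>i\<in>UNIV. u $ i - l $ i)"
proof -
  have "emeasure lborel (box l u) = ennreal (\<Prod>b\<in>Basis. (u - l) \<bullet> b)"
    by (rule emeasure_lborel_box) (use assms in \<open>auto simp: Basis_vec_def inner_axis\<close>)
  also have "(\<Prod>b\<in>Basis. (u - l) \<bullet> b) = (\<Prod>i\<in>UNIV. u $ i - l $ i)"
    by (simp add: Basis_vec_def cart_eq_inner_axis axis_eq_axis prod.UNION_disjoint inner_diff_left)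
  finally show ?thesis .
qed

text \<open>Relabelling sends boxes to boxes with the same side lengths, and the volumes of boxes
  characterise Lebesgue measure.\<close>

lemma lborel_recoord: "(lborel :: (real ^ ('n::finite) ordered_copy) measure) = distr lborel borel recoord"
proof (rule lborel_eqI)
  have meas: "recoord \<in> borel_measurable (borel :: (real ^ 'n) measure)"
    by (intro borel_measurable_continuous_onI linear_continuous_on)
      (simp add: linear_recoord flip: linear_conv_bounded_linear)
  fix l u :: "real ^ ('n::finite) ordered_copy"
  assume le: "\<And>b. b \<in> Basis \<Longrightarrow> l \<bullet> b \<le> u \<bullet> b"
  have le': "l $ i \<le> u $ i" for i using le[of "axis i 1"] by (simp add: inner_axis)
  let ?b = "\<lambda>v :: real ^ ('n::finite) ordered_copy. (\<chi> i. v $ to_copy i) :: real ^ 'n"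
  have vim: "recoord -` box l u = box (?b l) (?b u)"
    by (auto simp: mem_box_cart recoord_def) (metis of_to_copy, metis of_to_copy, metis of_copy_inverse, metis of_copy_inverse)
  have "emeasure (distr lborel borel recoord) (box l u) = emeasure lborel (box (?b l) (?b u))"
    using meas vim by (simp add: emeasure_distr)
  also have "\<dots> = ennreal (\<Prod>i\<in>UNIV. ?b u $ i - ?b l $ i)"
    by (rule emeasure_box_cart) (simp add: le')
  also have "(\<Prod>i\<in>UNIV. ?b u $ i - ?b l $ i) = (\<Prod>i\<in>UNIV. u $ i - l $ i)"
    by (rule prod.reindex_bij_betw[OF bij_of_copy, THEN sym, THEN trans]) (simp add: of_copy_inverse)
  also have "ennreal \<dots> = emeasure lborel (box l u)"
    by (rule emeasure_box_cart[symmetric]) (rule le')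
  also have "\<dots> = ennreal (\<Prod>b\<in>Basis. (u - l) \<bullet> b)" by (rule emeasure_lborel_box) (rule le)
  finally show "emeasure (distr lborel borel recoord) (box l u) = ennreal (\<Prod>b\<in>Basis. (u - l) \<bullet> b)" .
qed simp

lemma measure_recoord_compact:
  fixes S :: "(real ^ 'n) set"
  assumes "compact S"
  shows "measure lebesgue (recoord ` S) = measure lebesgue S"
proof -
  have meas: "recoord \<in> borel_measurable (borel :: (real ^ 'n) measure)"
    by (intro borel_measurable_continuous_onI linear_continuous_on)
      (simp add: linear_recoord flip: linear_conv_bounded_linear)
  have "compact (recoord ` S)"
    by (intro compact_continuous_image assms linear_continuous_on)
      (simp add: linear_recoord flip: linear_conv_bounded_linear)
  then have b: "recoord ` S \<in> sets borel" by (simp add: borel_compact)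
  have "measure lborel (recoord ` S) = measure lborel (recoord -` recoord ` S \<inter> space lborel)"
    by (subst lborel_recoord) (use meas b in \<open>simp add: measure_distr\<close>)
  also have "recoord -` recoord ` S \<inter> space lborel = S" using inj_recoord by (auto simp: inj_def)
  finally show ?thesis using b borel_compact[OF assms] by simp
qed

lemma simplex_volume:
  fixes X :: "(real ^ 'n) set"
  assumes X: "finite X" "card X = Suc CARD('n)" and x0: "x0 \<in> X" and bij: "bij_betw f (UNIV :: 'n set) (X - {x0})"
  shows "\<exists>M :: real ^ ('n::finite) ordered_copy ^ 'n ordered_copy.
    (\<forall>i j. M $ i $ j = f (of_copy j) $ of_copy i - x0 $ of_copy i) \<and>
    measure lebesgue (convex hull X) = \<bar>det M\<bar> / fact CARD('n)"
proof -
  define g where "g = recoord \<circ> f \<circ> of_copy"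
  have b1: "bij_betw g UNIV (recoord ` X - {recoord x0})"
  proof -
    have "bij_betw (f \<circ> of_copy) UNIV (X - {x0})" using bij_betw_trans[OF bij_of_copy bij] .
    moreover have "bij_betw recoord (X - {x0}) (recoord ` (X - {x0}))"
      using inj_recoord by (intro inj_on_imp_bij_betw) (rule inj_on_subset, auto)
    ultimately have "bij_betw g UNIV (recoord ` (X - {x0}))"
      unfolding g_def by (metis bij_betw_trans comp_assoc)
    also have "recoord ` (X - {x0}) = recoord ` X - {recoord x0}"
      using inj_recoord by (auto simp: inj_def)
    finally show ?thesis .
  qed
  have cX: "card (recoord ` X) = Suc CARD('n ordered_copy)"
    using card_image[OF inj_on_subset[OF inj_recoord subset_UNIV], of X] X card_ordered_copy[where 'n='n] by simp
  define M where "M = (\<chi> i. \<chi> j. g j $ i - recoord x0 $ i)"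
  have c: "compact (convex hull X)" using X by (simp add: finite_imp_compact_convex_hull)
  have "measure lebesgue (convex hull X) = measure lebesgue (recoord ` (convex hull X))"
    using measure_recoord_compact[OF c] by simp
  also have "recoord ` (convex hull X) = convex hull (recoord ` X)"
    by (rule convex_hull_linear_image[OF linear_recoord])
  also have "measure lebesgue \<dots> = measure lborel (convex hull (recoord ` X))"
    using X by (simp add: borel_compact finite_imp_compact_convex_hull)
  also have "\<dots> = \<bar>det M\<bar> / fact CARD('n)"
    unfolding M_def using content_simplex[OF _ cX _ b1] X x0 card_ordered_copy[where 'n='n] by simp
  finally show ?thesis
    by (intro exI[of _ M]) (auto simp: M_def g_def recoord_def)
qed

section \<open>Lattice simplices and triangulations\<close>

lemma det_Ints:
  fixes M :: "real ^ 'n ^ 'n"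
  assumes "\<And>i j. M $ i $ j \<in> \<int>"
  shows "det M \<in> \<int>"
  unfolding det_def by (intro Ints_sum Ints_mult Ints_prod assms) auto

text \<open>The determinant of the edge vectors is an integer, and affine independence of the
  vertices, expressed as linear independence at height 1, makes it non-zero; so its absolute value
  is at least 1.\<close>

lemma lattice_simplex_volume:
  fixes X :: "(real ^ 'n) set"
  assumes X: "finite X" "card X = Suc CARD('n)" "X \<subseteq> lattice_points"
    and ind: "independent ((\<lambda>x. (x, 1::real)) ` X)"
  shows "1 / fact CARD('n) \<le> measure lebesgue (convex hull X)"
proof -
  obtain x0 where x0: "x0 \<in> X" using X by fastforce
  have "card (X - {x0}) = CARD('n)" using X x0 by simp
  then obtain f where f: "bij_betw f (UNIV :: 'n set) (X - {x0})"
    using finite_same_card_bij[of "UNIV :: 'n set" "X - {x0}"] X by auto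
  obtain M :: "real ^ ('n::finite) ordered_copy ^ 'n ordered_copy" where
    M: "\<And>i j. M $ i $ j = f (of_copy j) $ of_copy i - x0 $ of_copy i"
      "measure lebesgue (convex hull X) = \<bar>det M\<bar> / fact CARD('n)"
    using simplex_volume[OF X(1,2) x0 f] by blast
  have fX: "f j \<in> X" "f j \<noteq> x0" for j using f by (auto simp: bij_betw_def)
  have "M $ i $ j \<in> \<int>" for i j
    unfolding M(1) using fX(1)[of "of_copy j"] x0 X(3) by (auto simp: lattice_points_def intro!: Ints_diff)
  then have "det M \<in> \<int>" by (rule det_Ints)
  moreover have "det M \<noteq> 0"
  proof -
    have "\<forall>c. (\<Sum>i\<in>UNIV. c i *s column i M) = 0 \<longrightarrow> (\<forall>i. c i = 0)"
    proof (intro allI impI)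
      fix c :: "'n ordered_copy \<Rightarrow> real" and i0
      assume s: "(\<Sum>i\<in>UNIV. c i *s column i M) = 0"
      define k where "k x = c (to_copy (inv_into UNIV f x))" for x
      define C where "C = (\<Sum>x\<in>X - {x0}. k x)"
      have kf: "k (f (of_copy j)) = c j" for j
        using f by (simp add: k_def bij_betw_def of_copy_inverse)
      have b: "bij_betw (f \<circ> of_copy) UNIV (X - {x0})" using bij_betw_trans[OF bij_of_copy f] .
      have "(\<Sum>x\<in>X - {x0}. k x *\<^sub>R (x - x0)) = 0"
      proof (rule vec_eq_iff[THEN iffD2], rule allI)
        fix i :: 'n
        define i' where "i' = to_copy i"
        have i: "i = of_copy i'" by (simp add: i'_def of_to_copy)
        have "(\<Sum>x\<in>X - {x0}. k x *\<^sub>R (x - x0)) $ i = (\<Sum>x\<in>X - {x0}. k x * (x $ i - x0 $ i))"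
          by simp
        also have "\<dots> = (\<Sum>j\<in>UNIV. k ((f \<circ> of_copy) j) * ((f \<circ> of_copy) j $ i - x0 $ i))"
          by (rule sum.reindex_bij_betw[OF b, symmetric])
        also have "\<dots> = (\<Sum>j\<in>UNIV. c j *s column j M) $ i'"
          by (simp add: kf i M(1) column_def)
        finally show "(\<Sum>x\<in>X - {x0}. k x *\<^sub>R (x - x0)) $ i = 0 $ i" using s by simp
      qed
      then have s1: "(\<Sum>x\<in>X - {x0}. k x *\<^sub>R x) - C *\<^sub>R x0 = 0"
        by (simp add: scaleR_diff_right sum_subtractf C_def scaleR_sum_left)
      \<comment> \<open>A relation between the edges at \<open>x0\<close> becomes one between the
        lifted vertices: giving \<open>x0\<close> minus the sum of the other coefficients cancels
        the heights.\<close>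
      define r where "r p = (if fst p = x0 then - C else k (fst p))" for p :: "(real ^ 'n) \<times> real"
      have inj: "inj_on (\<lambda>x. (x, 1::real)) X" by (simp add: inj_on_def)
      have "(\<Sum>p\<in>(\<lambda>x. (x, 1::real)) ` X. r p *\<^sub>R p) = (\<Sum>x\<in>X. r (x, 1) *\<^sub>R (x, 1::real))"
        by (simp add: sum.reindex[OF inj])
      also have "\<dots> = r (x0, 1) *\<^sub>R (x0, 1) + (\<Sum>x\<in>X - {x0}. r (x, 1) *\<^sub>R (x, 1))"
        by (rule sum.remove[OF X(1) x0])
      also have "(\<Sum>x\<in>X - {x0}. r (x, 1) *\<^sub>R (x, 1::real)) = (\<Sum>x\<in>X - {x0}. (k x *\<^sub>R x, k x))"
        by (intro sum.cong) (auto simp: r_def)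
      also have "\<dots> = (\<Sum>x\<in>X - {x0}. k x *\<^sub>R x, C)"
        by (simp add: C_def sum_prod)
      finally have "(\<Sum>p\<in>(\<lambda>x. (x, 1::real)) ` X. r p *\<^sub>R p) = 0"
        using s1 by (simp add: r_def zero_prod_def)
      then have z: "\<forall>p\<in>(\<lambda>x. (x, 1::real)) ` X. r p = 0" using ind by (simp only: independent_explicit) blast
      have "r (f (of_copy i0), 1) = 0" using z fX by blast
      then show "c i0 = 0" using fX(2) kf by (simp add: r_def)
    qed
    then show ?thesis
      using matrix_left_invertible_independent_columns[of M] invertible_left_inverse[of M] invertible_det_nz[of M] by blast
  qed
  ultimately have "1 \<le> \<bar>det M\<bar>" by (rule Ints_nonzero_abs_ge1)
  then show ?thesis unfolding M(2) by (simp add: divide_right_mono)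
qed

text \<open>At height 1 convex combinations turn into conic ones: the last coordinate records that
  the weights sum to 1.\<close>

lemma lift_convex_combination:
  fixes Y :: "'a::real_vector set"
  assumes "finite Y" "y \<in> convex hull Y"
  obtains \<mu> where "\<And>x. x \<in> Y \<Longrightarrow> 0 \<le> \<mu> x" "y = (\<Sum>x\<in>Y. \<mu> x *\<^sub>R x)" "sum \<mu> Y = 1"
    "(y, 1) = (\<Sum>p\<in>(\<lambda>x. (x, 1::real)) ` Y. \<mu> (fst p) *\<^sub>R p)"
proof -
  obtain \<mu> where \<mu>: "\<And>x. x \<in> Y \<Longrightarrow> 0 \<le> \<mu> x" "y = (\<Sum>x\<in>Y. \<mu> x *\<^sub>R x)" "sum \<mu> Y = 1"
    using assms by (auto simp: convex_hull_finite)
  have inj: "inj_on (\<lambda>x. (x, 1::real)) Y" by (simp add: inj_on_def)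
  have "(\<Sum>p\<in>(\<lambda>x. (x, 1::real)) ` Y. \<mu> (fst p) *\<^sub>R p) = (\<Sum>x\<in>Y. (\<mu> x *\<^sub>R x, \<mu> x))"
    by (simp add: sum.reindex[OF inj])
  also have "\<dots> = (y, 1)" using \<mu> by (simp add: sum_prod)
  finally show thesis using that[OF \<mu>] by simp
qed

text \<open>Two simplices coming from different cells meet inside the hull of their common vertices.
  Cells have equal cardinality, so at most \<open>CARD('n)\<close> vertices are common and the
  overlap is negligible; hence the volumes add up inside the hull of \<open>W\<close>.\<close>

lemma card_cells_le_volume:
  fixes W :: "(real ^ 'n) set"
  assumes W: "finite W" "W \<subseteq> lattice_points" "span ((\<lambda>x. (x, 1::real)) ` W) = UNIV"
  shows "real (card (cells ((\<lambda>x. (x, 1::real)) ` W) h)) / fact CARD('n) \<le> measure lebesgue (convex hull W)"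
proof -
  let ?l = "\<lambda>x :: real ^ 'n. (x, 1::real)"
  define T where "T = cells (?l ` W) h"
  define s where "s B = fst ` B" for B :: "((real ^ 'n) \<times> real) set"
  have bas: "is_basis B" if "B \<in> T" for B using that cells_basis W(3) by (auto simp: T_def)
  have sub: "B \<subseteq> ?l ` W" if "B \<in> T" for B
    using cells_subset[of B "?l ` W" h] that by (simp add: T_def)
  have lB: "?l ` s B = B" if "B \<subseteq> ?l ` W" for B using that by (force simp: s_def)
  have sW: "s B \<subseteq> W" if "B \<subseteq> ?l ` W" for B using that by (force simp: s_def)
  have fin: "finite (s B)" if "B \<subseteq> ?l ` W" for B using finite_subset[OF sW[OF that] W(1)] .
  have injl: "inj_on ?l A" for A by (simp add: inj_on_def)
  have crd: "card (s B) = card B" if "B \<subseteq> ?l ` W" for B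
    using card_image[OF injl, of "s B"] lB[OF that] by simp
  have cardB: "card B = Suc CARD('n)" if "B \<in> T" for B using basis_card[OF bas[OF that]] by simp
  have vol: "1 / fact CARD('n) \<le> measure lebesgue (convex hull (s B))" if B: "B \<in> T" for B
  proof (rule lattice_simplex_volume)
    show "s B \<subseteq> lattice_points" using sW[OF sub[OF B]] W(2) by blast
  qed (use fin[OF sub[OF B]] lB[OF sub[OF B]] crd[OF sub[OF B]] cardB[OF B] bas[OF B] in \<open>auto simp: is_basis_def\<close>)
  have cpt: "compact (convex hull (s B))" if "B \<subseteq> ?l ` W" for B
    using fin[OF that] by (simp add: finite_imp_compact_convex_hull)
  have negl: "negligible (convex hull (s B) \<inter> convex hull (s B'))" if B: "B \<in> T" "B' \<in> T" "B \<noteq> B'" for B B'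
  proof -
    have "convex hull (s B) \<inter> convex hull (s B') \<subseteq> convex hull (s (B \<inter> B'))"
    proof
      fix y assume y: "y \<in> convex hull (s B) \<inter> convex hull (s B')"
      obtain \<mu> where \<mu>: "\<And>x. x \<in> s B \<Longrightarrow> 0 \<le> \<mu> x" "y = (\<Sum>x\<in>s B. \<mu> x *\<^sub>R x)" "sum \<mu> (s B) = 1"
        "(y, 1) = (\<Sum>p\<in>?l ` s B. \<mu> (fst p) *\<^sub>R p)"
        by (rule lift_convex_combination[OF fin[OF sub[OF B(1)]], of y]) (use y in auto)
      obtain \<nu> where \<nu>: "\<And>x. x \<in> s B' \<Longrightarrow> 0 \<le> \<nu> x" "(y, 1) = (\<Sum>p\<in>?l ` s B'. \<nu> (fst p) *\<^sub>R p)"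
        by (rule lift_convex_combination[OF fin[OF sub[OF B(2)]], of y]) (use y in auto)
      have yB': "(y, 1) \<in> posc B'"
        by (rule poscI[of _ "\<lambda>p. \<nu> (fst p)"]) (use \<nu> lB[OF sub[OF B(2)]] in \<open>auto simp: s_def\<close>)
      have "p \<in> B'" if "p \<in> B" "\<mu> (fst p) \<noteq> 0" for p
      proof (rule cells_common_support[of B "?l ` W" h B' "(y, 1)" "\<lambda>p. \<mu> (fst p)"])
        show "(y, 1) = (\<Sum>p\<in>B. \<mu> (fst p) *\<^sub>R p)" using \<mu>(4) lB[OF sub[OF B(1)]] by simp
        show "0 \<le> \<mu> (fst v)" if "v \<in> B" for v using \<mu>(1) that by (auto simp: s_def)
      qed (use that B yB' W(1) in \<open>auto simp: T_def\<close>)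
      then have supp: "\<mu> x = 0" if "x \<in> s B - s (B \<inter> B')" for x
        using that by (force simp: s_def)
      have sB: "s (B \<inter> B') \<subseteq> s B" by (auto simp: s_def)
      have "y = (\<Sum>x\<in>s (B \<inter> B'). \<mu> x *\<^sub>R x)"
        unfolding \<mu>(2) by (rule sum.mono_neutral_right) (use fin[OF sub[OF B(1)]] sB supp in auto)
      moreover have "sum \<mu> (s (B \<inter> B')) = 1"
        unfolding \<mu>(3)[symmetric] by (rule sum.mono_neutral_left) (use fin[OF sub[OF B(1)]] sB supp in auto)
      ultimately show "y \<in> convex hull (s (B \<inter> B'))"
        using \<mu>(1) sB finite_subset[OF sB fin[OF sub[OF B(1)]]] by (auto simp: convex_hull_finite)
    qed
    moreover have "negligible (convex hull (s (B \<inter> B')))"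
    proof -
      have i: "B \<inter> B' \<subseteq> ?l ` W" using sub[OF B(1)] by auto
      have "B \<inter> B' \<subset> B"
      proof (rule ccontr)
        assume "\<not> ?thesis"
        then have "B \<subseteq> B'" by auto
        then show False
          using card_subset_eq[OF basis_finite[OF bas[OF B(2)]]] cardB[OF B(1)] cardB[OF B(2)] B(3) by simp
      qed
      then have "card (s (B \<inter> B')) < Suc CARD('n)"
        using psubset_card_mono[OF basis_finite[OF bas[OF B(1)]]] cardB[OF B(1)] crd[OF i] by simp
      then have "aff_dim (convex hull (s (B \<inter> B'))) < int CARD('n)"
        using aff_dim_le_card[OF fin[OF i]] by (simp add: aff_dim_convex_hull)
      then have "interior (convex hull (s (B \<inter> B'))) = {}" by (intro low_dim_interior) auto
      then show ?thesis by (simp add: negligible_convex_interior)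
    qed
    ultimately show ?thesis using negligible_subset by blast
  qed
  have finT: "finite T" using finite_cells[of "?l ` W" h] W(1) by (simp add: T_def)
  have "real (card T) / fact CARD('n) = (\<Sum>B\<in>T. 1 / fact CARD('n))" by simp
  also have "\<dots> \<le> (\<Sum>B\<in>T. measure lebesgue (convex hull (s B)))" by (rule sum_mono) (rule vol)
  also have "\<dots> = measure lebesgue (\<Union>B\<in>T. convex hull (s B))"
    by (rule measure_negligible_finite_Union_image[symmetric])
      (use finT cpt sub negl in \<open>auto simp: pairwise_def intro!: lmeasurable_compact\<close>)
  also have "\<dots> \<le> measure lebesgue (convex hull W)"
  proof (rule measure_mono_fmeasurable)
    show "(\<Union>B\<in>T. convex hull (s B)) \<subseteq> convex hull W" using sW sub by (blast dest: hull_mono[of _ _ convex, THEN subsetD])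
    show "(\<Union>B\<in>T. convex hull (s B)) \<in> sets lebesgue"
      by (intro sets.finite_UN finT fmeasurableD lmeasurable_compact cpt sub)
    show "convex hull W \<in> lmeasurable" using W(1) by (simp add: finite_imp_compact_convex_hull lmeasurable_compact)
  qed
  finally show ?thesis by (simp add: T_def)
qed

section \<open>Lattice polytopes\<close>

lemma finite_lattice_points:
  fixes S :: "(real ^ 'n) set"
  assumes "bounded S"
  shows "finite (S \<inter> lattice_points)"
proof -
  obtain N where N: "\<And>x. x \<in> S \<Longrightarrow> norm x \<le> N" using assms by (auto simp: bounded_iff)
  let ?R = "{- \<lceil>N\<rceil> .. \<lceil>N\<rceil>}"
  have "S \<inter> lattice_points \<subseteq> (\<lambda>f. \<chi> i. of_int (f i)) ` (UNIV \<rightarrow>\<^sub>E ?R)"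
  proof
    fix x assume x: "x \<in> S \<inter> lattice_points"
    have i: "of_int \<lfloor>x $ i\<rfloor> = x $ i" for i using x by (auto simp: lattice_points_def elim: Ints_cases)
    have R: "\<lfloor>x $ i\<rfloor> \<in> ?R" for i
    proof -
      have "\<bar>x $ i\<bar> \<le> N" using component_le_norm_cart[of x i] N[of x] x by auto
      then have "\<bar>real_of_int \<lfloor>x $ i\<rfloor>\<bar> \<le> of_int \<lceil>N\<rceil>" unfolding i by linarith
      then show ?thesis by (simp add: abs_le_iff)
    qed
    show "x \<in> (\<lambda>f. \<chi> i. of_int (f i)) ` (UNIV \<rightarrow>\<^sub>E ?R)"
    proof (rule image_eqI)
      show "x = (\<chi> i. of_int \<lfloor>x $ i\<rfloor>)" by (simp only: i vec_lambda_eta)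
    qed (use R in auto)
  qed
  moreover have "finite ((UNIV :: 'n set) \<rightarrow>\<^sub>E ?R)" by (intro finite_PiE) auto
  ultimately show ?thesis using finite_surj by blast
qed

text \<open>A segment from an interior point of a convex set to a frontier point is interior except
  for its end, so a ray from the origin meets the frontier at most once. Boundary points therefore
  qualify as new generators.\<close>

lemma frontier_distinct_rays:
  assumes P: "convex P" "closed P" "0 \<in> interior P"
    and x: "x \<in> frontier P" "w \<in> frontier P" "x \<noteq> w" "0 \<le> t"
  shows "x \<noteq> t *\<^sub>R (w :: 'a::euclidean_space)"
proof
  assume e: "x = t *\<^sub>R w"
  have n0: "x \<noteq> 0" "w \<noteq> 0" using P x by (auto simp: frontier_def)
  have *: False if "y = s *\<^sub>R z" "0 < s" "s < 1" "y \<in> frontier P" "z \<in> frontier P" "z \<noteq> 0" for y z :: 'a and s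
  proof -
    have "y \<in> open_segment 0 z" using that by (auto simp: in_segment)
    moreover have "open_segment 0 z \<subseteq> interior P"
      using that P by (intro in_interior_closure_convex_segment) (auto simp: frontier_def)
    ultimately show False using that by (auto simp: frontier_def)
  qed
  have "t \<noteq> 0" "t \<noteq> 1" using e n0 x by auto
  then consider "0 < t" "t < 1" | "1 < t" using x(4) by linarith
  then show False
  proof cases
    case 1
    then show False using * e x n0 by blast
  next
    case 2
    then have "w = (1 / t) *\<^sub>R x" using e by simp
    then show False using *[of w "1 / t" x] 2 x n0 by auto
  qed
qed

section \<open>Lifting to height 1\<close>

lemma lift_basis:
  fixes C :: "(real ^ 'n) set"
  assumes C: "is_basis C"
  shows "is_basis (insert (0, 1::real) ((\<lambda>x. (x, 1)) ` C))"
proof -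
  let ?l = "\<lambda>x :: real ^ 'n. (x, 1::real)"
  let ?C = "insert (0, 1) (?l ` C)"
  have fin: "finite C" using basis_finite[OF C] .
  have ind: "independent C" using C by (simp add: is_basis_def)
  have "0 \<notin> C" using ind dependent_zero by blast
  then have n: "(0, 1) \<notin> ?l ` C" by auto
  have inj: "inj_on ?l C" by (simp add: inj_on_def)
  have "independent ?C"
  proof (rule independent_if_scalars_zero)
    show "finite ?C" using fin by simp
    fix r p assume s: "(\<Sum>x\<in>?C. r x *\<^sub>R x) = 0" and p: "p \<in> ?C"
    have "(\<Sum>x\<in>?C. r x *\<^sub>R x) = r (0, 1) *\<^sub>R (0, 1) + (\<Sum>x\<in>C. r (x, 1) *\<^sub>R (x, 1))"
      using fin n by (simp add: sum.reindex[OF inj])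
    also have "(\<Sum>x\<in>C. r (x, 1) *\<^sub>R (x, 1::real)) = (\<Sum>x\<in>C. r (x, 1) *\<^sub>R x, \<Sum>x\<in>C. r (x, 1))"
      by (simp add: sum_prod)
    finally have e: "(\<Sum>x\<in>C. r (x, 1) *\<^sub>R x) = 0" "r (0, 1) + (\<Sum>x\<in>C. r (x, 1)) = 0"
      using s by (simp_all add: zero_prod_def)
    have "\<forall>x\<in>C. r (x, 1) = 0"
      using ind[unfolded independent_explicit] e(1) by (auto dest: spec[of _ "\<lambda>x. r (x, 1)"])
    then show "r p = 0" using e(2) p by auto
  qed
  moreover have "card ?C = DIM((real ^ 'n) \<times> real)"
    using fin n card_image[OF inj] basis_card[OF C] by simp
  then have "UNIV \<subseteq> span ?C" using calculation by (intro card_ge_dim_independent) auto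
  ultimately show ?thesis by (auto simp: is_basis_def)
qed

text \<open>Adding the last coordinate to \<open>f\<close> matches the shift of all costs by 1. The
  shift gives the apex \<open>(0, 1)\<close> a positive cost, as the simplex method requires, where
  \<open>f\<close> alone would give 0.\<close>

lemma lift_cells:
  fixes V :: "(real ^ 'n) set"
  assumes V: "span V = UNIV" "0 \<notin> V"
    and h: "\<And>x. x \<in> V \<Longrightarrow> h' (x, 1) = h x + 1" "h' (0, 1::real) = 1" and C: "C \<in> cells V h"
  shows "insert (0, 1) ((\<lambda>x. (x, 1)) ` C) \<in> cells (insert (0, 1) ((\<lambda>x. (x, 1)) ` V)) h'"
proof -
  obtain f where f: "linear f" "\<And>v. v \<in> C \<Longrightarrow> f v = h v" "\<And>w. w \<in> V - C \<Longrightarrow> f w < h w"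
    by (rule cellsE[OF C]) blast
  note CV = cells_subset[OF C]
  show ?thesis
  proof (rule cellsI[of _ _ "\<lambda>p. f (fst p) + snd p"])
    show "is_basis (insert (0, 1::real) ((\<lambda>x. (x, 1)) ` C))" by (rule lift_basis[OF cells_basis[OF C V(1)]])
    show "linear (\<lambda>p. f (fst p) + snd p)"
      by (intro linearI) (simp_all add: linear_add[OF f(1)] linear_cmul[OF f(1)] algebra_simps)
    show "f (fst p) + snd p < h' p"
      if p: "p \<in> insert (0, 1) ((\<lambda>x. (x, 1)) ` V) - insert (0, 1) ((\<lambda>x. (x, 1)) ` C)" for p
    proof -
      from p obtain x where "x \<in> V - C" "p = (x, 1)" by blast
      then show ?thesis using f(3) h(1) by simp
    qed
  qed (use h f(2) CV linear_0[OF f(1)] in auto)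
qed

text \<open>Central projection to height 1 is continuous on the open upper half-space, so the
  preimage of the interior of the hull is an open part of the cone.\<close>

lemma cone_over_interior:
  fixes V :: "(real ^ 'n) set"
  assumes V: "finite V" and x: "x \<in> interior (convex hull V)"
  shows "(x, 1::real) \<in> interior (posc ((\<lambda>x. (x, 1)) ` V))"
proof (rule interiorI)
  let ?l = "\<lambda>x :: real ^ 'n. (x, 1::real)"
  let ?S = "{p :: (real ^ 'n) \<times> real. 0 < snd p}"
  let ?g = "\<lambda>p :: (real ^ 'n) \<times> real. (1 / snd p) *\<^sub>R fst p"
  show "open (?S \<inter> ?g -` interior (convex hull V))"
  proof (rule continuous_open_preimage)
    show "continuous_on ?S ?g" by (intro continuous_intros) auto
    show "open ?S" by (intro open_Collect_less continuous_intros)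
  qed simp
  show "(x, 1) \<in> ?S \<inter> ?g -` interior (convex hull V)" using x by simp
  show "?S \<inter> ?g -` interior (convex hull V) \<subseteq> posc (?l ` V)"
  proof
    fix p assume p: "p \<in> ?S \<inter> ?g -` interior (convex hull V)"
    then have g: "?g p \<in> convex hull V" using interior_subset by blast
    obtain \<mu> where \<mu>: "\<And>x. x \<in> V \<Longrightarrow> 0 \<le> \<mu> x" "(?g p, 1) = (\<Sum>q\<in>?l ` V. \<mu> (fst q) *\<^sub>R q)"
      by (rule lift_convex_combination[OF V g]) blast
    have "p = snd p *\<^sub>R (?g p, 1)" using p by (cases p) simp
    also have "\<dots> = (\<Sum>q\<in>?l ` V. (snd p * \<mu> (fst q)) *\<^sub>R q)" unfolding \<mu>(2) by (simp add: scaleR_sum_right)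
    finally show "p \<in> posc (?l ` V)" by (rule poscI[rotated]) (use \<mu>(1) p in auto)
  qed
qed

lemma volume_bound_origin:
  fixes P :: "(real ^ 'n) set"
  assumes P: "compact P" "convex P" "0 \<in> interior P"
    and ext: "\<And>v. v extreme_point_of P \<Longrightarrow> v \<in> lattice_points"
  shows "(real CARD('n) * real (interior_count P) + (real CARD('n) - 1) * real (boundary_count P)
      - (real CARD('n))\<^sup>2 + 2) / fact CARD('n) \<le> measure lebesgue P"
proof -
  let ?l = "\<lambda>x :: real ^ 'n. (x, 1::real)"
  define V where "V = frontier P \<inter> lattice_points"
  define I where "I = interior P \<inter> lattice_points"
  define d where "d = CARD('n)"
  have d1: "1 \<le> d" by (simp add: d_def Suc_leI)
  have cl: "closed P" using P compact_imp_closed by blast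
  have VP: "V \<subseteq> P" "I \<subseteq> P" using cl interior_subset by (auto simp: V_def I_def frontier_def)
  have bdd: "bounded P" using P compact_imp_bounded by blast
  have finV: "finite V" and finI: "finite I"
    using finite_lattice_points[OF bdd] VP finite_subset[of _ "P \<inter> lattice_points"]
    by (auto simp: V_def I_def)
  have zI: "0 \<in> I" using P by (simp add: I_def lattice_points_def)
  have zV: "0 \<notin> V" using P by (simp add: V_def frontier_def)
  have "{x. x extreme_point_of P} \<subseteq> V"
    using ext extreme_point_not_in_interior cl
    by (auto simp: V_def frontier_def extreme_point_of_def)
  then have "P \<subseteq> convex hull V"
    using Krein_Milman_Minkowski[OF P(1,2)] hull_mono by blast
  then have PV: "P = convex hull V" using VP(1) P(2) by (simp add: hull_minimal subset_antisym)
  have spV: "span V = UNIV"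
  proof -
    have "affine hull P = UNIV" using P(3) by (intro affine_hull_nonempty_interior) auto
    then have "affine hull V = UNIV" using PV by (metis affine_hull_convex_hull)
    then show ?thesis using affine_hull_subset_span[of V] by auto
  qed
  obtain \<beta> where \<beta>: "\<And>v. v \<in> V \<Longrightarrow> 0 < \<beta> v" "(\<Sum>v\<in>V. \<beta> v *\<^sub>R v) = 0"
  proof -
    obtain e where e: "0 < e" "ball 0 e \<subseteq> P" using P(3) by (auto simp: mem_interior)
    \<comment> \<open>As 0 is interior, a small negative multiple of the sum of \<open>V\<close> is
      a convex combination of \<open>V\<close>. Adding \<epsilon> to all its weights gives a
      strictly positive relation.\<close>
    define s where "s = (\<Sum>v\<in>V. v)"
    define \<epsilon> where "\<epsilon> = e / (norm s + 1)"
    have n1: "0 < norm s + 1" using norm_ge_zero[of s] by linarith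
    have \<epsilon>: "0 < \<epsilon>" using e(1) n1 by (simp add: \<epsilon>_def)
    have "\<epsilon> * norm s < \<epsilon> * (norm s + 1)" using \<epsilon> by simp
    then have "norm (- (\<epsilon> *\<^sub>R s)) < e" using \<epsilon> n1 e(1) by (simp add: \<epsilon>_def)
    then have "- (\<epsilon> *\<^sub>R s) \<in> convex hull V" using e(2) PV by auto
    then obtain \<mu> where \<mu>: "\<And>v. v \<in> V \<Longrightarrow> 0 \<le> \<mu> v" "- (\<epsilon> *\<^sub>R s) = (\<Sum>v\<in>V. \<mu> v *\<^sub>R v)"
      unfolding convex_hull_finite[OF finV] by (auto dest: sym)
    have "(\<Sum>v\<in>V. (\<mu> v + \<epsilon>) *\<^sub>R v) = 0"
      by (simp add: scaleR_left_distrib sum.distrib \<mu>(2)[symmetric] s_def scaleR_sum_right)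
    then show thesis using that[of "\<lambda>v. \<mu> v + \<epsilon>"] \<mu>(1) \<epsilon> by (simp add: add_nonneg_pos)
  qed
  obtain W h where W: "W \<subseteq> V" "span W = UNIV" "\<forall>w\<in>W. 0 < h w" "UNIV \<subseteq> (\<Union>B\<in>cells W h. posc B)"
    "d \<le> card W" "2 + (d - 1) * (card W - d) \<le> card (cells W h)"
    using initial_fan[OF finV spV \<beta>] by (auto simp: d_def)
  have WV: "W \<union> (V - W) = V" using W(1) by auto
  have "\<exists>h'. (\<forall>w\<in>W \<union> (V - W). 0 < h' w) \<and> UNIV \<subseteq> (\<Union>B\<in>cells (W \<union> (V - W)) h'. posc B) \<and>
    card (cells W h) + (DIM(real ^ 'n) - 1) * card (V - W) \<le> card (cells (W \<union> (V - W)) h')"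
  proof (rule cells_insert_many)
    show "x \<noteq> t *\<^sub>R w" if "x \<in> V - W" "w \<in> W \<union> (V - W)" "x \<noteq> w" "0 \<le> t" for x w t
      using that unfolding WV by (intro frontier_distinct_rays[OF P(2) cl P(3)]) (auto simp: V_def)
  qed (use finV W finite_subset[OF W(1) finV] in auto)
  then obtain h1 where h1: "\<forall>v\<in>V. 0 < h1 v" "card (cells W h) + (d - 1) * card (V - W) \<le> card (cells V h1)"
    unfolding WV by (auto simp: d_def)
  have "card W \<le> card V" using W(1) finV by (simp add: card_mono)
  then have bd: "d \<le> card V" using W(5) by simp
  have "card V - d = (card W - d) + card (V - W)"
    using W(5) card_Diff_subset[OF finite_subset[OF W(1) finV] W(1)] \<open>card W \<le> card V\<close> by linarith
  then have "(d - 1) * (card V - d) = (d - 1) * (card W - d) + (d - 1) * card (V - W)"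
    by (simp only: distrib_left)
  then have N1: "2 + (d - 1) * (card V - d) \<le> card (cells V h1)" using W(6) h1(2) by linarith
  define W2 where "W2 = insert (0, 1) (?l ` V)"
  define h2 where "h2 p = (if fst p = 0 then 1 else h1 (fst p) + 1)" for p :: "(real ^ 'n) \<times> real"
  have finW2: "finite W2" using finV by (simp add: W2_def)
  have lift: "insert (0, 1) (?l ` C) \<in> cells W2 h2" if "C \<in> cells V h1" for C
    unfolding W2_def
    by (rule lift_cells[OF spV zV _ _ that]) (use zV in \<open>auto simp: h2_def\<close>)
  have inj: "inj_on (\<lambda>C. insert (0, 1) (?l ` C)) (cells V h1)"
  proof (rule inj_onI)
    fix C D assume a: "C \<in> cells V h1" "D \<in> cells V h1" "insert (0, 1) (?l ` C) = insert (0, 1) (?l ` D)"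
    have "fst ` insert (0, 1) (?l ` C) - {0} = C" "fst ` insert (0, 1) (?l ` D) - {0} = D"
      using a(1,2) cells_subset zV by (auto simp: image_image)
    then show "C = D" using a(3) by metis
  qed
  have N2: "card (cells V h1) \<le> card (cells W2 h2)"
    unfolding card_image[OF inj, symmetric]
    by (rule card_mono[OF finite_cells[OF finW2]]) (use lift in auto)
  have spW2: "span W2 = UNIV"
  proof -
    obtain C where C: "C \<in> cells V h1" using N1 by fastforce
    then have "insert (0, 1) (?l ` C) \<subseteq> W2" "span (insert (0, 1) (?l ` C)) = UNIV"
      using lift_basis[OF cells_basis[OF C spV]] cells_subset[OF C] by (auto simp: W2_def is_basis_def)
    then show ?thesis using span_mono by blast
  qed
  \<comment> \<open>The lifted cells correspond to simplices with apex 0 over boundary points, whose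
    union may be smaller than \<open>P\<close>. Insertion needs every interior point to lie inside
    the covered region, so the gap is filled first.\<close>
  have "\<exists>h'. (\<forall>w\<in>W2. 0 < h' w) \<and> cells W2 h2 \<subseteq> cells W2 h' \<and> posc W2 \<subseteq> (\<Union>B\<in>cells W2 h'. posc B)"
  proof (rule cells_refine[OF finW2 spW2])
    show "0 < h2 w" if "w \<in> W2" for w
      using that h1(1) by (auto simp: W2_def h2_def add_pos_pos)
  qed
  then obtain h3 where h3: "\<forall>w\<in>W2. 0 < h3 w" "cells W2 h2 \<subseteq> cells W2 h3"
    "posc W2 \<subseteq> (\<Union>B\<in>cells W2 h3. posc B)" by blast
  have N3: "card (cells W2 h2) \<le> card (cells W2 h3)"
    by (rule card_mono[OF finite_cells[OF finW2] h3(2)])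
  \<comment> \<open>The origin is already present as the apex, hence \<open>card I - 1\<close>
    insertions.\<close>
  let ?X = "?l ` (I - {0})"
  have IV: "I \<inter> V = {}" by (auto simp: I_def V_def frontier_def)
  have "\<exists>h'. (\<forall>w\<in>W2 \<union> ?X. 0 < h' w) \<and> posc W2 \<subseteq> (\<Union>B\<in>cells (W2 \<union> ?X) h'. posc B) \<and>
    card (cells W2 h3) + (DIM((real ^ 'n) \<times> real) - 1) * card ?X \<le> card (cells (W2 \<union> ?X) h')"
  proof (rule cells_insert_many[OF _ finW2 spW2])
    show "x \<noteq> t *\<^sub>R w" if "x \<in> ?X" "w \<in> W2 \<union> ?X" "x \<noteq> w" "0 \<le> t" for x w t
      using that by (auto simp: W2_def)
    show "?X \<inter> W2 = {}" using IV by (auto simp: W2_def)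
    have "interior (posc (?l ` V)) \<subseteq> interior (posc W2)"
      by (intro interior_mono posc_mono[OF finW2]) (auto simp: W2_def)
    then show "?X \<subseteq> interior (posc W2)"
      using cone_over_interior[OF finV] PV by (auto simp: I_def)
  qed (use finI h3 in auto)
  then obtain h4 where h4: "card (cells W2 h3) + d * card ?X \<le> card (cells (W2 \<union> ?X) h4)"
    by (auto simp: d_def)
  have W2X: "W2 \<union> ?X = ?l ` (V \<union> I)" using zI by (auto simp: W2_def)
  have "card ?X = card I - 1"
    using card_image[of ?l "I - {0}"] zI finI by (simp add: inj_on_def)
  then have N4: "2 + (d - 1) * (card V - d) + d * (card I - 1) \<le> card (cells (?l ` (V \<union> I)) h4)"
    using N1 N2 N3 h4 W2X by simp
  have I1: "1 \<le> card I" using zI finI by (metis One_nat_def Suc_leI card_gt_0_iff empty_iff)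
  \<comment> \<open>The truncated subtractions are exact by \<open>d1\<close>, \<open>bd\<close> and
    \<open>I1\<close>.\<close>
  have "real (2 + (d - 1) * (card V - d) + d * (card I - 1)) =
    real d * real (card I) + (real d - 1) * real (card V) - (real d)\<^sup>2 + 2"
    by (simp only: of_nat_add of_nat_mult of_nat_diff[OF d1] of_nat_diff[OF bd] of_nat_diff[OF I1])
      (simp add: algebra_simps power2_eq_square)
  then have "real d * real (card I) + (real d - 1) * real (card V) - (real d)\<^sup>2 + 2 \<le>
    real (card (cells (?l ` (V \<union> I)) h4))"
    using N4 by (metis of_nat_le_iff)
  then have "(real d * real (card I) + (real d - 1) * real (card V) - (real d)\<^sup>2 + 2) / fact d \<le>
    real (card (cells (?l ` (V \<union> I)) h4)) / fact d"
    by (intro divide_right_mono) auto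
  also have "\<dots> \<le> measure lebesgue (convex hull (V \<union> I))"
    unfolding d_def
  proof (rule card_cells_le_volume)
    show "span (?l ` (V \<union> I)) = UNIV" using spW2 span_mono[of W2 "W2 \<union> ?X"] W2X by auto
  qed (use finV finI in \<open>auto simp: V_def I_def\<close>)
  also have "convex hull (V \<union> I) = P"
    using PV VP P(2) by (intro subset_antisym hull_minimal) (auto intro: hull_mono[THEN subsetD])
  finally show ?thesis by (simp add: d_def V_def I_def boundary_count_def interior_count_def)
qed

theorem theorem2p2:
  fixes P :: "(real ^ 'n) set" and d :: nat
  assumes "d = CARD('n)"
    and "lattice_polytope P"
    and "aff_dim P = int d"
    and "interior_count P > 0"
  shows "measure lebesgue P \<ge>
    (real d * real (interior_count P) + (real d - 1) * real (boundary_count P) - (real d)\<^sup>2 + 2)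
      / fact d"
proof -
  obtain p where p: "p \<in> interior P" "p \<in> lattice_points"
    using assms(4) unfolding interior_count_def by (metis IntE card.empty equals0I less_irrefl)
  have P: "compact P" "convex P"
    using assms(2) by (auto simp: lattice_polytope_def polytope_imp_compact polytope_imp_convex)
  define Q where "Q = (+) (- p) ` P"
  \<comment> \<open>Translation by a lattice vector permutes the lattice, so both counts and the
    integrality of the vertices carry over.\<close>
  have L: "- p + x \<in> lattice_points \<longleftrightarrow> x \<in> lattice_points" for x
    using p(2) by (auto simp: lattice_points_def)
  have cnt: "card ((+) (- p) ` F \<inter> lattice_points) = card (F \<inter> lattice_points)" for F
  proof -
    have "(+) (- p) ` F \<inter> lattice_points = (+) (- p) ` (F \<inter> lattice_points)" using L by auto
    then show ?thesis by (simp add: card_image)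
  qed
  have "interior_count Q = interior_count P" "boundary_count Q = boundary_count P"
    unfolding interior_count_def boundary_count_def Q_def interior_translation frontier_translation
    by (rule cnt)+
  moreover have "measure lebesgue Q = measure lebesgue P" unfolding Q_def by (rule measure_translation)
  moreover have "(real CARD('n) * real (interior_count Q) + (real CARD('n) - 1) * real (boundary_count Q)
      - (real CARD('n))\<^sup>2 + 2) / fact CARD('n) \<le> measure lebesgue Q"
  proof (rule volume_bound_origin)
    show "compact Q" unfolding Q_def by (rule compact_translation[OF P(1)])
    show "convex Q" unfolding Q_def by (rule convex_translation[OF P(2)])
    show "0 \<in> interior Q" 
      unfolding Q_def interior_translation using p(1) by (intro image_eqI[of _ _ p]) auto
    show "v \<in> lattice_points" if v: "v extreme_point_of Q" for v
    proof -
      have "(p + v) extreme_point_of P"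
        using v extreme_point_of_translation_eq[of "- p" "p + v" P] by (simp add: Q_def)
      then show ?thesis using assms(2) L[of "p + v"] by (simp add: lattice_polytope_def)
    qed
  qed
  ultimately show ?thesis using assms(1) by simp
qed

end
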